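(* Let $\|\cdot\|$ be a diagonally weighted $\ell_1$ or $\ell_\infty$ norm on $\mathbb{R}^n$, let $F:\mathbb{R}^n\to\mathbb{R}^n$ be Lipschitz continuous with respect to $\|\cdot\|$, let $G:\mathbb{R}^n\to\mathbb{R}^n$ be continuous and monotone with respect to $\|\cdot\|$, and let $x^0\in\mathbb{R}^n$ be arbitrary. (i) If $F$ is strongly monotone with respect to $\|\cdot\|$ with monotonicity parameter $c>0$, then for every $\alpha\in]0,1/\mathrm{diagL}(F)]$ the iteration $x^{k+1}=J_{\alpha G}(x^k-\alpha F(x^k))$ converges to the unique zero $x^*$ of $F+G$, and for every $k\ge0$, $\|x^{k+1}-x^*\|\le(1-\alpha c)\|x^k-x^*\|$; this factor over this range is minimized at $\alpha=1/\mathrm{diagL}(F)$. (ii) If $F$ is monotone with respect to $\|\cdot\|$ and $\{x:(F+G)(x)=0\}\ne\emptyset$, then for every $\alpha\in]0,1/\mathrm{diagL}(F)]$ the iteration $x^{k+1}=\tfrac12x^k+\tfrac12J_{\alpha G}(x^k-\alpha F(x^k))$ converges to a zero of $F+G$.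
   Context: For $\eta\in\mathbb{R}^n_{>0}$, the diagonally weighted norms are $\|x\|_{1,[\eta]}=\sum_i\eta_i|x_i|$ and $\|x\|_{\infty,[\eta]^{-1}}=\max_i|x_i|/\eta_i$. A weak pairing (WP) on $\mathbb{R}^n$ is a map $[\![\cdot,\cdot]\!]:\mathbb{R}^n\times\mathbb{R}^n\to\mathbb{R}$ that is subadditive and continuous in its first argument, satisfies $[\![\alpha x,y]\!]=[\![x,\alpha y]\!]=\alpha[\![x,y]\!]$ for $\alpha\ge0$ and $[\![-x,-y]\!]=[\![x,y]\!]$, $[\![x,x]\!]>0$ for $x\ne0$, and $|[\![x,y]\!]|\le[\![x,x]\!]^{1/2}[\![y,y]\!]^{1/2}$; it is compatible with a norm if $[\![x,x]\!]=\|x\|^2$. WPs are assumed to also satisfy Deimling's inequality $[\![x,y]\!]\le\|y\|\lim_{h\to0^+}h^{-1}(\|y+hx\|-\|y\|)$ and the curve norm derivative formula ($\|x(t)\|D^+\|x(t)\|=[\![\dot x(t),x(t)]\!]$ a.e. for differentiable curves). A map $H$ is monotone with monotonicity parameter $c\ge0$ w.r.t. $\|\cdot\|$ if for some compatible WP, $-[\![-(H(x)-H(y)),x-y]\!]\ge c\|x-y\|^2$ for all $x,y$ (monotone: $c=0$; strongly monotone: $c>0$). For continuous monotone $G$ and $\alpha>0$, $J_{\alpha G}=(\mathrm{Id}+\alpha G)^{-1}$ is single-valued and defined on all of $\mathbb{R}^n$. For Lipschitz $F$, $\mathrm{diagL}(F):=\sup_{x\in\mathbb{R}^n\setminus\Omega_F}\max_{i}(DF(x))_{ii}$,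 where $\Omega_F$ is the measure-zero set where $F$ is not differentiable. *)

theory Defs
  imports "HOL-Analysis.Analysis" "HOL-Library.Liminf_Limsup"
begin

definition norm1w :: "real^'n \<Rightarrow> real^'n \<Rightarrow> real" where
  "norm1w eta x = (\<Sum>i\<in>UNIV. eta$i * \<bar>x$i\<bar>)"

definition norminfw :: "real^'n \<Rightarrow> real^'n \<Rightarrow> real" where
  "norminfw eta x = Max (range (\<lambda>i. \<bar>x$i\<bar> / eta$i))"

definition dini_upper_right :: "(real \<Rightarrow> real) \<Rightarrow> real \<Rightarrow> ereal" where
  "dini_upper_right f t = Limsup (at_right 0) (\<lambda>h. ereal ((f (t + h) - f t) / h))"

text \<open>Weak pairing compatible with the norm nrm, including Deimling's inequality
  and the curve norm derivative formula.\<close>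
definition compatible_wp :: "(real^'n \<Rightarrow> real) \<Rightarrow> (real^'n \<Rightarrow> real^'n \<Rightarrow> real) \<Rightarrow> bool" where
  "compatible_wp nrm P \<longleftrightarrow>
     (\<forall>x1 x2 y. P (x1 + x2) y \<le> P x1 y + P x2 y) \<and>
     (\<forall>y. continuous_on UNIV (\<lambda>x. P x y)) \<and>
     (\<forall>a x y. a \<ge> 0 \<longrightarrow> P (a *\<^sub>R x) y = a * P x y \<and> P x (a *\<^sub>R y) = a * P x y) \<and>
     (\<forall>x y. P (- x) (- y) = P x y) \<and>
     (\<forall>x. x \<noteq> 0 \<longrightarrow> P x x > 0) \<and>
     (\<forall>x y. \<bar>P x y\<bar> \<le> sqrt (P x x) * sqrt (P y y)) \<and>
     (\<forall>x. P x x = (nrm x)\<^sup>2) \<and>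
     (\<forall>x y D. ((\<lambda>h. (nrm (y + h *\<^sub>R x) - nrm y) / h) \<longlongrightarrow> D) (at_right 0)
              \<longrightarrow> P x y \<le> nrm y * D) \<and>
     (\<forall>\<gamma> \<gamma>'. (\<forall>t. (\<gamma> has_vector_derivative \<gamma>' t) (at t)) \<longrightarrow>
        (AE t in lborel. ereal (nrm (\<gamma> t)) * dini_upper_right (\<lambda>s. nrm (\<gamma> s)) t
                          = ereal (P (\<gamma>' t) (\<gamma> t))))"

definition monotone_wrt :: "(real^'n \<Rightarrow> real) \<Rightarrow> real \<Rightarrow> (real^'n \<Rightarrow> real^'n) \<Rightarrow> bool" where
  "monotone_wrt nrm c H \<longleftrightarrow> c \<ge> 0 \<and>
     (\<exists>P. compatible_wp nrm P \<and>
          (\<forall>x y. - P (- (H x - H y)) (x - y) \<ge> c * (nrm (x - y))\<^sup>2))"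

definition lipschitz_wrt :: "(real^'n \<Rightarrow> real) \<Rightarrow> (real^'n \<Rightarrow> real^'n) \<Rightarrow> bool" where
  "lipschitz_wrt nrm F \<longleftrightarrow> (\<exists>L. \<forall>x y. nrm (F x - F y) \<le> L * nrm (x - y))"

definition resolvent :: "real \<Rightarrow> (real^'n \<Rightarrow> real^'n) \<Rightarrow> real^'n \<Rightarrow> real^'n" where
  "resolvent a G y = (THE x. x + a *\<^sub>R G x = y)"

definition diagL :: "(real^'n \<Rightarrow> real^'n) \<Rightarrow> real" where
  "diagL F = Sup {(frechet_derivative F (at x) (axis i 1)) $ i | x i. F differentiable (at x)}"

end

theory Submission
  imports Defs
begin

text \<open>
  Since \<^const>\<open>diagL\<close> only sees points of differentiability, Rademacher's theorem is what turns it
  into the bound \<open>F\<^sub>i (x + s e\<^sub>i) - F\<^sub>i x \<le> s diagL F\<close> for \<open>s \<ge> 0\<close>. Deimling's inequality determines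
  the weak pairing wherever the norm is differentiable, and by continuity of \<open>F\<close> the resulting
  monotonicity inequality extends to all pairs of points. Together they show, for \<open>\<alpha> diagL F \<le> 1\<close>, that
  \<open>Id - \<alpha> F\<close> is Lipschitz with constant \<open>1 - \<alpha> c\<close>: for the 1-norm one walks from \<open>y\<close> to \<open>x\<close> along
  the coordinate axes, for the max-norm one moves a single coordinate until it realises the norm.
  The resolvent exists by invariance of domain, because \<open>Id + \<alpha> G\<close> is continuous and does not
  decrease distances, and it is nonexpansive. The iteration is then a contraction in case (i),
  and a Krasnoselskii iteration of a nonexpansive map in case (ii), whose residuals vanish by the
  Goebel--Kirk inequality in any normed space.

  Rademacher's theorem is proved by showing that one-sided directional derivatives exist almost
  everywhere (a one-dimensional density argument, transferred by Tonelli) and are almost everywhere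
  additive in the direction (compare integrals over boxes).
\<close>

subsection \<open>One-sided derivatives of Lipschitz functions on the real line\<close>

text \<open>The bound \<open>a * diagL F \<le> 1\<close> says that the diagonal of Id - a DF stays
  nonnegative. The absolute value of a diagonal term then opens without loss, and monotonicity,
  which lets the diagonal term dominate the off-diagonal ones, turns into the factor
  \<open>1 - a * c\<close>. The argument runs on finite differences of \<open>F\<close>, because DF
  may fail to exist along a whole segment; the only derivative information it needs is a scalar
  bound on the increments of the i-th component along the i-th axis. The pairings of
  \<open>F\<close> and \<open>G\<close> may be different, so they cannot simply be added to make
  \<open>F + G\<close> strongly monotone; in (i) the zero comes from the forward estimate instead.
  In (ii) the plain iterates of a nonexpansive map need not converge, hence the average with weight
  1/2. As the norms in general come from no inner product, the usual quadratic identities for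
  averaged maps are replaced by a residual estimate that uses only the triangle inequality.\<close>

lemma le_if_locally_not_decreasing:
  fixes g :: "real \<Rightarrow> real"
  assumes "a \<le> b" and cont: "continuous_on {a..b} g"
    and step: "\<And>x. a \<le> x \<Longrightarrow> x < b \<Longrightarrow> \<exists>y. x < y \<and> y \<le> b \<and> g x \<le> g y"
  shows "g a \<le> g b"
proof -
  \<comment> \<open>\<open>S\<close> is closed by continuity and so has a last point; if that point
    lay before \<open>b\<close>, \<open>step\<close> would lead beyond it inside
    \<open>S\<close>.\<close>
  define S where "S = {x \<in> {a..b}. g a \<le> g x}"
  have "closed S"
    unfolding S_def using continuous_on_closed_Collect_le[OF continuous_on_const cont closed_atLeastAtMost] .
  moreover have "S \<subseteq> {a..b}" by (auto simp: S_def)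
  then have "bounded S" by (rule bounded_subset[rotated]) simp
  ultimately have "compact S" by (simp add: compact_eq_bounded_closed)
  moreover have "a \<in> S" using \<open>a \<le> b\<close> by (simp add: S_def)
  ultimately obtain s where s: "s \<in> S" "\<And>t. t \<in> S \<Longrightarrow> t \<le> s"
    by (metis compact_attains_sup empty_iff)
  have "s = b"
  proof (rule ccontr)
    assume "s \<noteq> b"
    then obtain y where "s < y" "y \<le> b" "g s \<le> g y"
      using step[of s] s(1) by (auto simp: S_def)
    then have "y \<in> S" using s(1) by (auto simp: S_def)
    with s(2) \<open>s < y\<close> show False by fastforce
  qed
  with s(1) show ?thesis by (simp add: S_def)
qed

text \<open>Disjoint balls of a Vitali cover, taken inside an open \<open>U\<close> slightly larger
  than a bounded piece \<open>S\<close> of \<open>A\<close>, fill \<open>S\<close> up to a null set.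
  Summing the density bound over them gives |S| \<le> \<theta> (|S| + e), which for finite |S| and
  \<theta> < 1 leaves only |S| = 0.\<close>

lemma null_set_if_ball_density_le:
  fixes A :: "'a::euclidean_space set" and \<theta> :: real
  assumes A: "A \<in> sets borel" and \<theta>: "0 \<le> \<theta>" "\<theta> < 1"
    and density: "\<And>x r. r > 0 \<Longrightarrow>
      emeasure lborel (A \<inter> cball x r) \<le> ennreal \<theta> * emeasure lborel (cball x r)"
  shows "A \<in> null_sets lborel"
proof -
  have bounded_null: "emeasure lborel (A \<inter> ball 0 R) = 0" for R
  proof -
    define S where "S = A \<inter> ball 0 R"
    have S[measurable]: "S \<in> sets borel" unfolding S_def using A by auto
    have fin: "emeasure lborel S < \<infinity>"
      by (rule emeasure_bounded_finite) (auto simp: S_def intro: bounded_subset[OF bounded_ball])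
    have le: "emeasure lborel S \<le> ennreal \<theta> * (emeasure lborel S + ennreal e)" if e: "e > 0" for e
    proof -
      obtain U where U: "open U" "S \<subseteq> U" "emeasure lborel (U - S) < e"
        using outer_regular_lborel[OF S e] by blast
      define K where "K = {(x, r). r > 0 \<and> cball x r \<subseteq> U}"
      obtain C where C: "countable C" "C \<subseteq> K"
          "pairwise (\<lambda>i j. disjnt (cball (fst i) (snd i)) (cball (fst j) (snd j))) C"
          "negligible (S - (\<Union>i\<in>C. cball (fst i) (snd i)))"
      proof (rule Vitali_covering_theorem_cballs[of K snd S fst])
        show "\<And>i. i \<in> K \<Longrightarrow> 0 < snd i" by (auto simp: K_def)
        fix x and d :: real assume "x \<in> S" "0 < d"
        then obtain r where "r > 0" "cball x r \<subseteq> U" using U open_contains_cball by blast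
        then show "\<exists>i. i \<in> K \<and> x \<in> cball (fst i) (snd i) \<and> snd i < d"
          using \<open>0 < d\<close> by (intro exI[of _ "(x, min r (d/2))"]) (auto simp: K_def)
      qed
      let ?B = "\<lambda>i. cball (fst i) (snd i)"
      have disj: "disjoint_family_on ?B C"
        using C(3) by (auto simp: disjoint_family_on_def pairwise_def disjnt_def)
      then have disj': "disjoint_family_on (\<lambda>i. S \<inter> ?B i) C"
        by (rule disjoint_family_on_bisimulation) auto
      have U_meas: "(\<Union>i\<in>C. ?B i) \<in> sets lborel"
        by (rule sets.countable_UN'[OF C(1)]) (rule image_subsetI, simp)
      define Z where "Z = S - (\<Union>i\<in>C. ?B i)"
      have Z: "Z \<in> sets lborel" unfolding Z_def using S U_meas by simp
      have "Z \<in> null_sets lebesgue" using C(4) by (simp add: negligible_iff_null_sets Z_def)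
      then have null: "emeasure lborel Z = 0"
        using null_sets_completion_iff[OF Z] by (simp add: null_sets_def)
      have "emeasure lborel S \<le> emeasure lborel (Z \<union> (S \<inter> (\<Union>i\<in>C. ?B i)))"
        by (rule emeasure_mono) (use S Z U_meas in \<open>auto simp: Z_def\<close>)
      also have "\<dots> \<le> emeasure lborel Z + emeasure lborel (S \<inter> (\<Union>i\<in>C. ?B i))"
        by (rule emeasure_subadditive) (use S Z U_meas in simp_all)
      also have "\<dots> = emeasure lborel (\<Union>i\<in>C. S \<inter> ?B i)"
        by (simp only: null add_0 Int_UN_distrib)
      also have "\<dots> = (\<integral>\<^sup>+i. emeasure lborel (S \<inter> ?B i) \<partial>count_space C)"
        using S C(1) disj' by (intro emeasure_UN_countable) auto
      also have "\<dots> \<le> (\<integral>\<^sup>+i. ennreal \<theta> * emeasure lborel (?B i) \<partial>count_space C)"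
      proof (rule nn_integral_mono)
        fix i assume "i \<in> space (count_space C)"
        then have "snd i > 0" using C(2) by (auto simp: K_def)
        have "emeasure lborel (S \<inter> ?B i) \<le> emeasure lborel (A \<inter> ?B i)"
          using A by (intro emeasure_mono) (auto simp: S_def)
        also have "\<dots> \<le> ennreal \<theta> * emeasure lborel (?B i)"
          using density \<open>snd i > 0\<close> by blast
        finally show "emeasure lborel (S \<inter> ?B i) \<le> ennreal \<theta> * emeasure lborel (?B i)" .
      qed
      also have "\<dots> = ennreal \<theta> * (\<integral>\<^sup>+i. emeasure lborel (?B i) \<partial>count_space C)"
        by (rule nn_integral_cmult) simp
      also have "\<dots> = ennreal \<theta> * emeasure lborel (\<Union>i\<in>C. ?B i)"
        using C(1) disj by (subst emeasure_UN_countable) auto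
      also have "\<dots> \<le> ennreal \<theta> * emeasure lborel (S \<union> (U - S))"
      proof (intro mult_left_mono emeasure_mono)
        show "(\<Union>i\<in>C. ?B i) \<subseteq> S \<union> (U - S)" using C(2) unfolding K_def by force
      qed (use U S in auto)
      also have "\<dots> \<le> ennreal \<theta> * (emeasure lborel S + emeasure lborel (U - S))"
        using U S by (intro mult_left_mono emeasure_subadditive) auto
      also have "\<dots> \<le> ennreal \<theta> * (emeasure lborel S + ennreal e)"
        using U(3) by (intro mult_left_mono add_left_mono) auto
      finally show ?thesis .
    qed
    define m where "m = measure lborel S"
    have m: "emeasure lborel S = ennreal m" "m \<ge> 0"
      using fin by (auto simp: m_def emeasure_eq_ennreal_measure)
    have "m \<le> \<theta> * m + e" if "e > 0" for e
    proof -
      have "ennreal m \<le> ennreal (\<theta> * (m + e))"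
        using le[OF that] m \<theta> that by (simp add: ennreal_mult'' flip: ennreal_plus)
      then have "m \<le> \<theta> * (m + e)" using m \<theta> that by (subst (asm) ennreal_le_iff) auto
      also have "\<dots> \<le> \<theta> * m + e" using \<theta> that by (simp add: distrib_left mult_left_le_one_le)
      finally show ?thesis .
    qed
    then have "m \<le> \<theta> * m" by (rule field_le_epsilon)
    then have "(1 - \<theta>) * m \<le> 0" by (simp add: algebra_simps)
    then have "m = 0" using \<theta> m(2) by (simp add: mult_le_0_iff)
    with m show ?thesis by (simp add: S_def)
  qed
  have "(\<Union>n::nat. ball (0::'a) (real n)) = UNIV"
    using reals_Archimedean2 by auto
  then have "A = (\<Union>n::nat. A \<inter> ball 0 (real n))" by blast
  also have "\<dots> \<in> null_sets lborel"
    using A bounded_null by (intro null_sets_UN) (auto simp: null_sets_def)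
  finally show ?thesis .
qed

text \<open>Up to the boundary case of equality, these are the points whose upper right Dini
  derivative along \<open>v\<close> exceeds \<open>q\<close>. In this division-free form, adding a
  linear function to \<open>f\<close> just shifts \<open>q\<close>.\<close>

definition steep_set :: "('a::real_normed_vector \<Rightarrow> real) \<Rightarrow> 'a \<Rightarrow> real \<Rightarrow> 'a set" where
  "steep_set f v q = {x. \<exists>\<^sub>F h in at_right 0. f (x + h *\<^sub>R v) - f x > q * h}"

lemma frequently_at_right_0:
  "(\<exists>\<^sub>F h in at_right (0::real). P h) \<longleftrightarrow> (\<forall>e>0. \<exists>h. 0 < h \<and> h < e \<and> P h)"
  by (auto simp: frequently_def eventually_at_right_field)

text \<open>For each bound 1/(n+1) the union over all real \<open>h\<close> is already open, so
  countability is needed only for the bounds and not for \<open>h\<close>.\<close>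

lemma steep_set_borel:
  fixes f :: "'a::euclidean_space \<Rightarrow> real"
  assumes cont: "continuous_on UNIV f"
  shows "steep_set f v q \<in> sets borel"
proof -
  define W where "W n = (\<Union>h\<in>{0<..<1 / real (Suc n)}. {x. q * h < f (x + h *\<^sub>R v) - f x})" for n
  have "open {x. q * h < f (x + h *\<^sub>R v) - f x}" for h
    by (intro open_Collect_less continuous_intros continuous_on_compose2[OF cont] subset_UNIV)
  then have "open (W n)" for n unfolding W_def by blast
  then have "(\<Inter>n. W n) \<in> sets borel" by (intro sets.countable_INT) auto
  moreover have "steep_set f v q = (\<Inter>n. W n)"
  proof (intro equalityI subsetI)
    fix x assume "x \<in> steep_set f v q"
    then have "\<exists>h>0. h < 1 / real (Suc n) \<and> f (x + h *\<^sub>R v) - f x > q * h" for n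
      unfolding steep_set_def frequently_at_right_0 by simp
    then show "x \<in> (\<Inter>n. W n)" unfolding W_def by fastforce
  next
    fix x assume x: "x \<in> (\<Inter>n. W n)"
    show "x \<in> steep_set f v q"
      unfolding steep_set_def frequently_at_right_0 mem_Collect_eq
    proof (intro allI impI)
      fix e :: real assume "e > 0"
      then obtain n where n: "1 / real (Suc n) < e" using nat_approx_posE by blast
      from x obtain h where "0 < h" "h < 1 / real (Suc n)" "q * h < f (x + h *\<^sub>R v) - f x"
        unfolding W_def by force
      with n show "\<exists>h>0. h < e \<and> q * h < f (x + h *\<^sub>R v) - f x"
        by (intro exI[of _ h]) auto
    qed
  qed
  ultimately show ?thesis by simp
qed

text \<open>Let C be a compact part of the steep set. At a point of C some step h raises
  \<open>f\<close> by more than q h, while the measure of C passed on the way grows by at most h;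
  off C that measure is locally constant and \<open>f\<close> is monotone. So \<open>f x\<close>
  minus q times the measure of C up to x satisfies
  \<open>le_if_locally_not_decreasing\<close>.\<close>

lemma steep_set_measure_le_mono:
  fixes f :: "real \<Rightarrow> real"
  assumes "mono f" and cont: "continuous_on UNIV f" and "0 \<le> q" and "a \<le> b"
  shows "q * measure lborel (steep_set f 1 q \<inter> {a..b}) \<le> f b - f a"
proof -
  define S where "S = steep_set f 1 q \<inter> {a..b}"
  have S: "S \<in> sets borel" unfolding S_def using steep_set_borel[OF cont] by auto
  have compact_case: "q * measure lborel C \<le> f b - f a" if "compact C" "C \<subseteq> S" for C
  proof -
    have C[measurable]: "C \<in> sets borel" using that by (simp add: compact_imp_closed)
    define m where "m x = measure lborel (C \<inter> {a..x})" for x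
    have fm: "C \<inter> X \<in> fmeasurable lborel" if "X \<in> sets borel" for X
      using that by (intro fmeasurable_Int_fmeasurable fmeasurable_compact \<open>compact C\<close>) simp
    have m_diff: "m y = m x + measure lborel (C \<inter> {x<..y})" if "a \<le> x" "x \<le> y" for x y
    proof -
      have "C \<inter> {a..y} = (C \<inter> {a..x}) \<union> (C \<inter> {x<..y})" using that by auto
      then show ?thesis unfolding m_def
        using fm by (subst measure_Union[symmetric]) (auto simp: fmeasurableD2)
    qed
    have m_le: "measure lborel (C \<inter> {x<..y}) \<le> y - x" if "x \<le> y" for x y
    proof -
      have "measure lborel (C \<inter> {x<..y}) \<le> measure lborel {x<..y}"
        using that by (intro measure_mono_fmeasurable fmeasurableI) auto
      then show ?thesis using that by simp
    qed
    have "1-lipschitz_on {a..b} m"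
    proof (rule lipschitz_on_leI)
      fix x y assume "x \<in> {a..b}" "y \<in> {a..b}" "x \<le> y"
      then show "dist (m x) (m y) \<le> 1 * dist x y"
        using m_diff[of x y] m_le[of x y] by (auto simp: dist_real_def)
    qed simp
    then have "continuous_on {a..b} m" by (rule lipschitz_on_continuous_on)
    then have G: "continuous_on {a..b} (\<lambda>x. f x - q * m x)"
      by (intro continuous_intros continuous_on_subset[OF cont]) auto
    have "f a - q * m a \<le> f b - q * m b"
    proof (rule le_if_locally_not_decreasing[OF \<open>a \<le> b\<close> G])
      fix x assume x: "a \<le> x" "x < b"
      show "\<exists>y. x < y \<and> y \<le> b \<and> f x - q * m x \<le> f y - q * m y"
      proof (cases "x \<in> C")
        case True
        then have "x \<in> steep_set f 1 q" using that by (auto simp: S_def)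
        then obtain h where h: "0 < h" "h < b - x" "q * h < f (x + h) - f x"
          unfolding steep_set_def frequently_at_right_0 using x by (auto dest: spec[of _ "b - x"])
        have "q * measure lborel (C \<inter> {x<..x+h}) \<le> q * h"
          using m_le[of x "x + h"] h \<open>0 \<le> q\<close> by (intro mult_left_mono) auto
        then show ?thesis using h x m_diff[of x "x + h"]
          by (intro exI[of _ "x + h"]) (auto simp: distrib_left)
      next
        case False
        then obtain e where e: "e > 0" "ball x e \<inter> C = {}"
          using compact_imp_closed[OF \<open>compact C\<close>]
          by (metis Compl_iff disjoint_eq_subset_Compl open_Compl open_contains_ball)
        define y where "y = min b (x + e/2)"
        have y: "x < y" "y \<le> b" "y < x + e" using e x by (auto simp: y_def)
        have "C \<inter> {x<..y} = {}" using e y by (auto simp: dist_real_def disjoint_iff)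
        then have "m y = m x" using m_diff[of x y] x y by simp
        moreover have "f x \<le> f y" using \<open>mono f\<close> y by (simp add: monoD)
        ultimately show ?thesis using y by auto
      qed
    qed
    moreover have "m a = 0"
    proof -
      have "m a \<le> measure lborel {a..a}" unfolding m_def
        by (intro measure_mono_fmeasurable fmeasurableI) auto
      then show ?thesis by (simp add: m_def measure_le_0_iff)
    qed
    moreover have "C \<inter> {a..b} = C" using that by (auto simp: S_def)
    ultimately show ?thesis by (simp add: m_def)
  qed
  \<comment> \<open>Inner regularity passes from compact subsets to \<open>S\<close> itself; in
    \<open>compact_case\<close>, closedness gave each point off C a neighbourhood free of C.\<close>
  have *: "q * measure lborel S \<le> (f b - f a) + q * e" if e: "e > 0" for e
  proof -
    obtain T where T: "closed T" "T \<subseteq> S" "S - T \<in> lmeasurable" "emeasure lebesgue (S - T) < ennreal e"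
      using sets_lebesgue_inner_closed[of S e] S e by (metis sets_completionI_sets sets_lborel)
    have "T \<subseteq> {a..b}" using T by (auto simp: S_def)
    then have "compact T" using T(1) compact_eq_bounded_closed bounded_subset by blast
    have [measurable]: "T \<in> sets borel" using T(1) by auto
    have fin: "S \<in> fmeasurable lborel" "T \<in> fmeasurable lborel"
      using S \<open>T \<subseteq> S\<close> \<open>T \<subseteq> {a..b}\<close>
      by (auto intro!: fmeasurableI2[OF fmeasurable_cbox[of a b]] simp: S_def)
    have "emeasure lborel (S - T) < ennreal e" using T(4) S by simp
    then have "measure lborel (S - T) < e"
      using that by (metis measure_def enn2real_less_iff ennreal_less_top order_less_trans)
    moreover have "measure lborel S = measure lborel T + measure lborel (S - T)"
      using measurable_measure_Diff[of S lborel T] fin T(2) by (simp add: fmeasurableD)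
    ultimately have "measure lborel S \<le> measure lborel T + e" by simp
    then have "q * measure lborel S \<le> q * (measure lborel T + e)" using \<open>0 \<le> q\<close> by (rule mult_left_mono)
    then show ?thesis using compact_case[OF \<open>compact T\<close> T(2)] by (simp add: distrib_left)
  qed
  have "q * measure lborel S \<le> (f b - f a) + e" if "e > 0" for e
  proof (cases "q = 0")
    case True
    then show ?thesis using *[of 1] that by simp
  next
    case False
    then show ?thesis using *[of "e/q"] that \<open>0 \<le> q\<close> by simp
  qed
  then show ?thesis unfolding S_def by (rule field_le_epsilon)
qed

text \<open>The estimates for \<^term>\<open>\<lambda>x. L * x + g x\<close> and \<^term>\<open>\<lambda>x. L * x - g x\<close> add up to a bound
  on the density of the oscillation set in every interval by a constant below 1.\<close>

lemma steep_sets_null_real: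
  fixes g :: "real \<Rightarrow> real"
  assumes lip: "L-lipschitz_on UNIV g" and "p < q"
  shows "steep_set g 1 q \<inter> steep_set (\<lambda>x. - g x) 1 (- p) \<in> null_sets lborel"
proof -
  have L: "L \<ge> 0" using lip by (rule lipschitz_on_nonneg)
  have gL: "\<bar>g x - g y\<bar> \<le> L * \<bar>x - y\<bar>" for x y
    using lipschitz_onD[OF lip, of x y] by (simp add: dist_real_def)
  have cont: "continuous_on UNIV g" using lip by (rule lipschitz_on_continuous_on)
  let ?f1 = "\<lambda>x. L * x + g x" and ?f2 = "\<lambda>x. L * x - g x"
  have mono: "mono ?f1" "mono ?f2"
  proof -
    have "L * x + g x \<le> L * y + g y \<and> L * x - g x \<le> L * y - g y" if "x \<le> y" for x y
      using gL[of x y] that by (simp add: abs_if algebra_simps split: if_splits)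
    then show "mono ?f1" "mono ?f2" by (auto simp: mono_def)
  qed
  have steep1: "steep_set g 1 q = steep_set ?f1 1 (q + L)"
    by (simp add: steep_set_def algebra_simps)
  have steep2: "steep_set (\<lambda>x. - g x) 1 (- p) = steep_set ?f2 1 (L - p)"
    by (simp add: steep_set_def algebra_simps)
  let ?A = "steep_set g 1 q \<inter> steep_set (\<lambda>x. - g x) 1 (- p)"
  have A: "?A \<in> sets borel"
    by (intro sets.Int steep_set_borel continuous_intros cont)
  \<comment> \<open>The measure estimate needs slopes that are nonnegative after the shift by
    \<open>L\<close>. In the first two cases \<open>p\<close> and \<open>q\<close> lie on the same
    side outside [-L, L], where all slopes of \<open>g\<close> are, and one of the steep sets is
    empty.\<close>
  consider "q + L < 0" | "L - p < 0" | "0 \<le> q + L" "0 \<le> L - p" by linarith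
  then show ?thesis
  proof cases
    case 1
    have bound: "p * h \<le> g (x + h) - g x" if "0 < h" for x h
    proof -
      have "p * h \<le> - L * h" using 1 \<open>p < q\<close> that by (intro mult_right_mono) auto
      also have "\<dots> \<le> g (x + h) - g x" using gL[of "x + h" x] that by (simp add: abs_le_iff)
      finally show ?thesis .
    qed
    have "\<not> (\<exists>h>0. h < 1 \<and> - g (x + h *\<^sub>R 1) - - g x > - p * h)" for x
    proof clarify
      fix h :: real
      assume "0 < h" "- p * h < - g (x + h *\<^sub>R 1) - - g x"
      then show False using bound[of h x] by simp
    qed
    then have "steep_set (\<lambda>x. - g x) 1 (- p) = {}"
      unfolding steep_set_def frequently_at_right_0 using zero_less_one by blast
    then show ?thesis by simp
  next
    case 2
    have bound: "g (x + h) - g x \<le> q * h" if "0 < h" for x h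
    proof -
      have "g (x + h) - g x \<le> L * h" using gL[of "x + h" x] that by (simp add: abs_le_iff)
      also have "\<dots> \<le> q * h" using 2 \<open>p < q\<close> that by (intro mult_right_mono) auto
      finally show ?thesis .
    qed
    have "\<not> (\<exists>h>0. h < 1 \<and> g (x + h *\<^sub>R 1) - g x > q * h)" for x
    proof clarify
      fix h :: real
      assume "0 < h" "q * h < g (x + h *\<^sub>R 1) - g x"
      then show False using bound[of h x] by simp
    qed
    then have "steep_set g 1 q = {}"
      unfolding steep_set_def frequently_at_right_0 using zero_less_one by blast
    then show ?thesis by simp
  next
    case 3
    \<comment> \<open>The two shifted functions add up to \<open>2 * L * x\<close>, and their
      steepness thresholds to \<open>2 * L + (q - p)\<close>; the density bound is the quotient of
      the two rates.\<close>
    define \<theta> where "\<theta> = 2 * L / (2 * L + (q - p))"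
    have den: "2 * L + (q - p) > 0" using L \<open>p < q\<close> by simp
    show ?thesis
    proof (rule null_set_if_ball_density_le[OF A])
      show "0 \<le> \<theta>" "\<theta> < 1" using L \<open>p < q\<close> den by (auto simp: \<theta>_def)
      fix x r :: real assume "r > 0"
      define a b where "a = x - r" and "b = x + r"
      have ab: "a \<le> b" and cb: "cball x r = {a..b}"
        using \<open>r > 0\<close> by (auto simp: a_def b_def cball_eq_atLeastAtMost)
      have fm: "S \<inter> {a..b} \<in> fmeasurable lborel" if "S \<in> sets borel" for S
        using that by (intro fmeasurableI2[OF fmeasurable_cbox[of a b]]) auto
      define m where "m = measure lborel (?A \<inter> {a..b})"
      have cf: "continuous_on UNIV ?f1" "continuous_on UNIV ?f2"
        by (intro continuous_intros cont)+
      have "m \<le> measure lborel (steep_set g 1 q \<inter> {a..b})"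
        unfolding m_def using A fm steep_set_borel[OF cont]
        by (intro measure_mono_fmeasurable) (auto simp: fmeasurableD)
      then have "(q + L) * m \<le> (q + L) * measure lborel (steep_set ?f1 1 (q + L) \<inter> {a..b})"
        using 3 steep1 by (intro mult_left_mono) auto
      also have "\<dots> \<le> ?f1 b - ?f1 a"
        by (rule steep_set_measure_le_mono[OF mono(1) cf(1) 3(1) ab])
      finally have le1: "(q + L) * m \<le> ?f1 b - ?f1 a" .
      have "m \<le> measure lborel (steep_set (\<lambda>x. - g x) 1 (- p) \<inter> {a..b})"
        unfolding m_def using A fm steep_set_borel[OF continuous_on_minus[OF cont]]
        by (intro measure_mono_fmeasurable) (auto simp: fmeasurableD)
      then have "(L - p) * m \<le> (L - p) * measure lborel (steep_set ?f2 1 (L - p) \<inter> {a..b})"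
        using 3 steep2 by (intro mult_left_mono) auto
      also have "\<dots> \<le> ?f2 b - ?f2 a"
        by (rule steep_set_measure_le_mono[OF mono(2) cf(2) 3(2) ab])
      finally have "(2 * L + (q - p)) * m \<le> 2 * L * (b - a)"
        using le1 by (simp add: algebra_simps)
      then have "m \<le> \<theta> * (b - a)" using den by (simp add: \<theta>_def field_simps)
      moreover have "emeasure lborel (?A \<inter> {a..b}) = ennreal m"
        unfolding m_def by (rule emeasure_eq_measure2) (rule fm[OF A])
      ultimately show "emeasure lborel (?A \<inter> cball x r) \<le> ennreal \<theta> * emeasure lborel (cball x r)"
        unfolding cb using ab \<open>0 \<le> \<theta>\<close> by (simp add: ennreal_leI flip: ennreal_mult)
    qed
  qed
qed

text \<open>Tonelli on \<open>(x, t)\<close> together with translation invariance avoids splitting off the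
  direction \<open>v\<close> as a coordinate.\<close>

lemma null_set_if_null_on_lines:
  fixes N :: "'a::euclidean_space set"
  assumes N: "N \<in> sets borel" and lines: "\<And>x. AE t in lborel. x + t *\<^sub>R v \<notin> N"
  shows "N \<in> null_sets lborel"
proof -
  have meas: "(\<lambda>(x, t). x + t *\<^sub>R v) \<in> borel_measurable (lborel \<Otimes>\<^sub>M (lborel :: real measure))"
    by measurable
  have "{z \<in> space (lborel \<Otimes>\<^sub>M (lborel :: real measure)). fst z + snd z *\<^sub>R v \<notin> N}
      \<in> sets (lborel \<Otimes>\<^sub>M lborel)"
    using measurable_sets[OF meas, of "- N"] N
    by (simp add: vimage_def case_prod_unfold Int_def conj_commute)
  then have "(AE t in lborel. AE x in lborel. x + t *\<^sub>R v \<notin> N)"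
    using lborel_pair.AE_commute[where P = "\<lambda>x t. x + t *\<^sub>R v \<notin> N"] lines by blast
  moreover have "ae_filter (lborel :: real measure) \<noteq> bot"
    by (simp add: ae_filter_eq_bot_iff)
  ultimately obtain t where t: "AE x in lborel. x + t *\<^sub>R v \<notin> N"
    using eventually_happens' by blast
  have "AE y in distr lborel borel ((+) (- (t *\<^sub>R v))). y + t *\<^sub>R v \<notin> N"
    unfolding lborel_distr_plus by (rule t)
  then have "AE x in lborel. x \<notin> N"
    using N by (subst (asm) AE_distr_iff) auto
  then show ?thesis using N by (subst (asm) AE_iff_null_sets[symmetric]) auto
qed

text \<open>If liminf and limsup differ, two rationals strictly between them witness an oscillation;
  the bound \<open>K\<close> keeps the common value finite. Restricting to rationals later leaves a
  countable union of null sets.\<close>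

lemma tendsto_if_no_oscillation:
  fixes u :: "'a \<Rightarrow> real"
  assumes "F \<noteq> bot" and bounded: "\<forall>\<^sub>F h in F. \<bar>u h\<bar> \<le> K"
    and no_osc: "\<And>p q. p \<in> \<rat> \<Longrightarrow> q \<in> \<rat> \<Longrightarrow> p < q \<Longrightarrow>
      \<not> ((\<exists>\<^sub>F h in F. u h > q) \<and> (\<exists>\<^sub>F h in F. u h < p))"
  shows "\<exists>l. (u \<longlongrightarrow> l) F"
proof -
  let ?I = "Liminf F (\<lambda>h. ereal (u h))" and ?S = "Limsup F (\<lambda>h. ereal (u h))"
  have "?I \<le> ?S" by (rule Liminf_le_Limsup) fact
  have low: "ereal (- K) \<le> ?I"
    by (rule Liminf_bounded) (use bounded in \<open>auto elim!: eventually_mono\<close>)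
  have up: "?S \<le> ereal K"
    by (rule Limsup_bounded) (use bounded in \<open>auto elim!: eventually_mono\<close>)
  have "?I = ?S"
  proof (rule ccontr)
    assume "?I \<noteq> ?S"
    then have "?I < ?S" using \<open>?I \<le> ?S\<close> by simp
    then obtain a b where ab: "?I < ereal a" "ereal a < ereal b" "ereal b < ?S"
      by (metis ereal_dense2 less_ereal.simps(1))
    from ab(2) obtain p where p: "p \<in> \<rat>" "a < p" "p < b" using Rats_dense_in_real[of a b] by auto
    then obtain q where q: "q \<in> \<rat>" "p < q" "q < b" using Rats_dense_in_real[of p b] by auto
    have "\<exists>\<^sub>F h in F. u h > q"
    proof (rule ccontr)
      assume "\<not> (\<exists>\<^sub>F h in F. u h > q)"
      then have "?S \<le> ereal q"
        by (intro Limsup_bounded) (auto simp: not_frequently not_less)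
      with ab q show False by (meson ereal_less_eq(3) leD less_imp_le order_trans)
    qed
    moreover have "\<exists>\<^sub>F h in F. u h < p"
    proof (rule ccontr)
      assume "\<not> (\<exists>\<^sub>F h in F. u h < p)"
      then have "ereal p \<le> ?I"
        by (intro Liminf_bounded) (auto simp: not_frequently not_less)
      with ab p show False by (meson ereal_less_eq(3) leD less_imp_le order_trans)
    qed
    ultimately show False using no_osc[OF p(1) q(1,2)] by blast
  qed
  then have "((\<lambda>h. ereal (u h)) \<longlongrightarrow> ?S) F" using \<open>F \<noteq> bot\<close> by (simp add: tendsto_Limsup)
  moreover obtain l where "?S = ereal l"
    using low up \<open>?I = ?S\<close> by (cases ?S) auto
  ultimately show ?thesis by auto
qed

section \<open>Difference quotients along a direction\<close>

definition right_quotient :: "('a::real_normed_vector \<Rightarrow> real) \<Rightarrow> 'a \<Rightarrow> 'a \<Rightarrow> real \<Rightarrow> real" where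
  "right_quotient f v x h = (f (x + h *\<^sub>R v) - f x) / h"

lemma right_quotient_bound:
  assumes "L-lipschitz_on UNIV f"
  shows "\<bar>right_quotient f v x h\<bar> \<le> L * norm v"
proof (cases "h = 0")
  case True
  then show ?thesis using lipschitz_on_nonneg[OF assms] by (simp add: right_quotient_def)
next
  case False
  have "\<bar>f (x + h *\<^sub>R v) - f x\<bar> \<le> L * (\<bar>h\<bar> * norm v)"
    using lipschitz_onD[OF assms, of "x + h *\<^sub>R v" x] by (simp add: dist_norm)
  then show ?thesis using False by (simp add: right_quotient_def divide_le_eq mult_ac)
qed

text \<open>On each line in direction \<open>v\<close> the function is Lipschitz in one real
  variable, so every oscillation set meets the line in a null set. Tonelli makes the set itself
  null, and a union over rational pairs finishes.\<close>

lemma right_quotient_converges_AE: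
  fixes f :: "'a::euclidean_space \<Rightarrow> real"
  assumes lip: "L-lipschitz_on UNIV f"
  shows "AE x in lborel. \<exists>l. (right_quotient f v x \<longlongrightarrow> l) (at_right 0)"
proof -
  have cont: "continuous_on UNIV f" using lip by (rule lipschitz_on_continuous_on)
  have pq: "AE x in lborel. x \<notin> steep_set f v q \<inter> steep_set (\<lambda>x. - f x) v (- p)"
    if "p < q" for p q
  proof -
    let ?N = "steep_set f v q \<inter> steep_set (\<lambda>x. - f x) v (- p)"
    have "?N \<in> null_sets lborel"
    proof (rule null_set_if_null_on_lines[where v = v])
      show "?N \<in> sets borel" by (intro sets.Int steep_set_borel continuous_intros cont)
      fix x
      let ?g = "\<lambda>t. f (x + t *\<^sub>R v)"
      have "(L * norm v)-lipschitz_on UNIV ?g"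
      proof (rule lipschitz_onI)
        fix s t :: real
        have "dist (?g s) (?g t) \<le> L * dist (x + s *\<^sub>R v) (x + t *\<^sub>R v)"
          using lipschitz_onD[OF lip] by blast
        then show "dist (?g s) (?g t) \<le> L * norm v * dist s t"
          by (simp add: dist_norm mult_ac flip: scaleR_diff_left)
      qed (simp add: lipschitz_on_nonneg[OF lip])
      then have "steep_set ?g 1 q \<inter> steep_set (\<lambda>t. - ?g t) 1 (- p) \<in> null_sets lborel"
        using \<open>p < q\<close> by (rule steep_sets_null_real)
      moreover have "x + t *\<^sub>R v \<in> ?N \<longleftrightarrow> t \<in> steep_set ?g 1 q \<inter> steep_set (\<lambda>t. - ?g t) 1 (- p)" for t
        by (simp add: steep_set_def scaleR_add_left add.assoc)
      ultimately show "AE t in lborel. x + t *\<^sub>R v \<notin> ?N"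
        by (simp only:) (rule AE_not_in)
    qed
    then show ?thesis by (rule AE_not_in)
  qed
  have "AE x in lborel. \<forall>p\<in>\<rat>. \<forall>q\<in>\<rat>. p < q \<longrightarrow>
      x \<notin> steep_set f v q \<inter> steep_set (\<lambda>x. - f x) v (- p)"
  proof -
    have "AE x in lborel. p < q \<longrightarrow> x \<notin> steep_set f v q \<inter> steep_set (\<lambda>x. - f x) v (- p)" for p q
      using pq[of p q] by (cases "p < q") auto
    then show ?thesis by (simp add: AE_ball_countable countable_rat)
  qed
  then show ?thesis
  proof eventually_elim
    case (elim x)
    show ?case
    proof (rule tendsto_if_no_oscillation)
      show "\<forall>\<^sub>F h in at_right 0. \<bar>right_quotient f v x h\<bar> \<le> L * norm v"
        using right_quotient_bound[OF lip] by simp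
      fix p q :: real assume "p \<in> \<rat>" "q \<in> \<rat>" "p < q"
      have pos: "\<forall>\<^sub>F h in at_right (0::real). h > 0" by (rule eventually_at_right_less)
      have "(\<exists>\<^sub>F h in at_right 0. right_quotient f v x h > q) \<Longrightarrow> x \<in> steep_set f v q"
        unfolding steep_set_def right_quotient_def mem_Collect_eq
        by (erule frequently_rev_mp) (use pos in \<open>auto elim!: eventually_mono simp: field_simps\<close>)
      moreover have "(\<exists>\<^sub>F h in at_right 0. right_quotient f v x h < p)
          \<Longrightarrow> x \<in> steep_set (\<lambda>x. - f x) v (- p)"
        unfolding steep_set_def right_quotient_def mem_Collect_eq
        by (erule frequently_rev_mp) (use pos in \<open>auto elim!: eventually_mono simp: field_simps\<close>)
      ultimately show "\<not> ((\<exists>\<^sub>F h in at_right 0. right_quotient f v x h > q) \<and>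
          (\<exists>\<^sub>F h in at_right 0. right_quotient f v x h < p))"
        using elim \<open>p \<in> \<rat>\<close> \<open>q \<in> \<rat>\<close> \<open>p < q\<close> by blast
    qed simp
  qed
qed

subsection \<open>Rademacher's theorem\<close>

abbreviation step :: "nat \<Rightarrow> real" where
  "step n \<equiv> inverse (real (Suc n))"

text \<open>A limit along one fixed sequence is a total and measurable function of the base point,
  with an unspecified value where it diverges. Where the one-sided derivative exists the two agree
  (\<open>right_derivI\<close>).\<close>

definition right_deriv :: "('a::real_normed_vector \<Rightarrow> real) \<Rightarrow> 'a \<Rightarrow> 'a \<Rightarrow> real" where
  "right_deriv f v x = lim (\<lambda>n. right_quotient f v x (step n))"

lemma step_at_right: "filterlim step (at_right 0) sequentially"
  by (rule tendsto_imp_filterlim_at_right[OF LIMSEQ_inverse_real_of_nat]) simp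

lemma right_derivI:
  assumes "(right_quotient f v x \<longlongrightarrow> l) (at_right 0)"
  shows "(\<lambda>n. right_quotient f v x (step n)) \<longlonglongrightarrow> l" and "right_deriv f v x = l"
proof -
  show "(\<lambda>n. right_quotient f v x (step n)) \<longlonglongrightarrow> l"
    using filterlim_compose[OF assms step_at_right] .
  then show "right_deriv f v x = l" unfolding right_deriv_def by (rule limI)
qed

text \<open>Lebesgue measure with density \<open>1 + c * g\<close> agrees with Lebesgue measure on
  boxes, hence everywhere, and densities are unique a.e. The choice
  \<open>c = 1 / (1 + \<bar>M\<bar>)\<close> keeps that density nonnegative.\<close>

lemma AE_zero_if_box_integrals_zero:
  fixes g :: "'a::euclidean_space \<Rightarrow> real"
  assumes g[measurable]: "g \<in> borel_measurable borel" and bound: "AE x in lborel. \<bar>g x\<bar> \<le> M"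
    and zero: "\<And>a b. (\<integral>x\<in>box a b. g x \<partial>lborel) = 0"
  shows "AE x in lborel. g x = 0"
proof -
  define c where "c = 1 / (1 + \<bar>M\<bar>)"
  have c: "c > 0" by (simp add: c_def)
  define w where "w x = 1 + c * g x" for x
  have [measurable]: "w \<in> borel_measurable borel" unfolding w_def by measurable
  have w_nonneg: "AE x in lborel. 0 \<le> w x"
    using bound
  proof eventually_elim
    case (elim x)
    then have "\<bar>g x\<bar> \<le> 1 + \<bar>M\<bar>" by linarith
    then have "\<bar>c * g x\<bar> \<le> 1" by (simp add: c_def abs_mult)
    then show ?case unfolding w_def by linarith
  qed
  have "lborel = density lborel (\<lambda>x. ennreal (w x))"
  proof (rule lborel_eqI)
    fix l u :: 'a assume lu: "\<And>b. b \<in> Basis \<Longrightarrow> l \<bullet> b \<le> u \<bullet> b"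
    have int_g: "set_integrable lborel (box l u) g"
      unfolding set_integrable_def
      by (rule integrableI_bounded_set_indicator[where B = M])
        (use bound in \<open>auto simp: emeasure_lborel_box_eq elim!: eventually_mono\<close>)
    have int_1: "set_integrable lborel (box l u) (\<lambda>_. 1 :: real)"
      unfolding set_integrable_def by (simp add: emeasure_lborel_box_eq)
    have int_w: "set_integrable lborel (box l u) w"
      unfolding w_def using int_g int_1 by (intro set_integral_add(1) set_integrable_mult_right)
    have "emeasure (density lborel (\<lambda>x. ennreal (w x))) (box l u)
        = (\<integral>\<^sup>+x. ennreal (indicat_real (box l u) x *\<^sub>R w x) \<partial>lborel)"
      by (auto simp: emeasure_density indicator_def intro!: nn_integral_cong)
    also have "\<dots> = ennreal (\<integral>x\<in>box l u. w x \<partial>lborel)"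
      unfolding set_lebesgue_integral_def
      using int_w w_nonneg
      by (intro nn_integral_eq_integral) (auto simp: set_integrable_def elim!: eventually_mono)
    also have "(\<integral>x\<in>box l u. w x \<partial>lborel) = measure lborel (box l u)"
      unfolding w_def
      by (subst set_integral_add(2)) (use zero in \<open>auto simp: int_1 int_g set_lebesgue_integral_def\<close>)
    also have "ennreal \<dots> = (\<Prod>b\<in>Basis. (u - l) \<bullet> b)"
      using lu by (simp add: measure_lborel_box_eq)
    finally show "emeasure (density lborel (\<lambda>x. ennreal (w x))) (box l u) = (\<Prod>b\<in>Basis. (u - l) \<bullet> b)" .
  qed simp
  then have "density lborel (\<lambda>_. 1) = density lborel (\<lambda>x. ennreal (w x))"
    by (simp add: density_1)
  then have "AE x in lborel. 1 = ennreal (w x)"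
    by (rule sigma_finite_measure.density_unique[OF sigma_finite_lborel, rotated 2]) auto
  with w_nonneg show ?thesis
  proof eventually_elim
    case (elim x)
    then have "w x = 1" by (metis ennreal_eq_1)
    then show ?case using c by (simp add: w_def)
  qed
qed

section \<open>Almost everywhere linearity of the directional derivative\<close>

context
  fixes f :: "'a::euclidean_space \<Rightarrow> real" and L :: real
  assumes lip: "L-lipschitz_on UNIV f"
begin

lemma borel_measurable_lipschitz [measurable]: "f \<in> borel_measurable borel"
  using lipschitz_on_continuous_on[OF lip] by (rule borel_measurable_continuous_onI)

lemma borel_measurable_right_quotient [measurable]:
  "(\<lambda>x. right_quotient f v x h) \<in> borel_measurable borel"
  unfolding right_quotient_def by measurable

lemma borel_measurable_right_deriv [measurable]: "right_deriv f v \<in> borel_measurable borel"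
  unfolding right_deriv_def[abs_def] by measurable

lemma right_deriv_tendsto_AE:
  "AE x in lborel. (right_quotient f v x \<longlongrightarrow> right_deriv f v x) (at_right 0)"
  using right_quotient_converges_AE[OF lip, of v] by eventually_elim (use right_derivI(2) in blast)

lemma right_deriv_bound_AE: "AE x in lborel. \<bar>right_deriv f v x\<bar> \<le> L * norm v"
  using right_deriv_tendsto_AE[of v]
proof eventually_elim
  case (elim x)
  then have "(\<lambda>n. \<bar>right_quotient f v x (step n)\<bar>) \<longlonglongrightarrow> \<bar>right_deriv f v x\<bar>"
    using right_derivI(1) tendsto_rabs by blast
  then show ?case
    by (rule LIMSEQ_le_const2) (use right_quotient_bound[OF lip] in blast)
qed

text \<open>The base point moves with \<open>n\<close>, so convergence of the quotients at fixed
  points does not apply directly. A substitution moves the shift into the indicator of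
  \<open>U\<close>, which converges off the frontier; hence the condition on
  \<open>frontier U\<close>. Since \<open>step n \<le> 1\<close>, the ball \<open>B\<close> contains
  all the shifted sets and carries the dominating function.\<close>

lemma integral_shifted_right_quotient_tendsto:
  fixes U :: "'a set"
  assumes U: "bounded U" "U \<in> sets borel" "negligible (frontier U)"
  shows "(\<lambda>n. \<integral>x\<in>U. right_quotient f w (x + step n *\<^sub>R v) (step n) \<partial>lborel)
    \<longlonglongrightarrow> (\<integral>x\<in>U. right_deriv f w x \<partial>lborel)"
proof -
  obtain R where R: "R > 0" "\<And>x. x \<in> U \<Longrightarrow> norm x \<le> R" using U(1) bounded_pos by blast
  define B where "B = cball (0::'a) (R + norm v)"
  have step1: "step n \<le> 1" "step n > 0" for n by (auto simp: field_simps)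
  let ?s = "\<lambda>n y. indicat_real U (y - step n *\<^sub>R v) *\<^sub>R right_quotient f w y (step n)"
  have shift: "(\<integral>x\<in>U. right_quotient f w (x + step n *\<^sub>R v) (step n) \<partial>lborel)
      = (\<integral>y. ?s n y \<partial>lborel)" for n
  proof -
    have "(\<integral>y. ?s n y \<partial>lborel) = (\<integral>y. ?s n y \<partial>distr lborel borel ((+) (step n *\<^sub>R v)))"
      by (simp only: lborel_distr_plus)
    also have "\<dots> = (\<integral>x. ?s n (step n *\<^sub>R v + x) \<partial>lborel)"
      using U(2) by (intro integral_distr) auto
    finally show ?thesis by (simp add: set_lebesgue_integral_def add.commute)
  qed
  have "(\<lambda>n. \<integral>y. ?s n y \<partial>lborel) \<longlonglongrightarrow> (\<integral>y. indicat_real U y *\<^sub>R right_deriv f w y \<partial>lborel)"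
  proof (rule integral_dominated_convergence[where w = "\<lambda>y. indicat_real B y * (L * norm w)"])
    show "(\<lambda>y. indicat_real U y *\<^sub>R right_deriv f w y) \<in> borel_measurable lborel"
      using U(2) by measurable
    show "?s n \<in> borel_measurable lborel" for n
      using U(2) by measurable
    show "integrable lborel (\<lambda>y. indicat_real B y * (L * norm w))"
      unfolding B_def by (intro integrable_mult_left integrable_real_indicator)
        (auto intro: emeasure_bounded_finite[unfolded infinity_ennreal_def])
    have "AE y in lborel. y \<notin> frontier U"
    proof -
      have "frontier U \<in> null_sets lborel"
        using U(3) null_sets_completion_iff[of "frontier U" lborel]
        by (auto simp: negligible_iff_null_sets frontier_closed borel_closed)
      then show ?thesis by (rule AE_not_in)
    qed
    with right_deriv_tendsto_AE[of w]
    show "AE y in lborel. (\<lambda>n. ?s n y) \<longlonglongrightarrow> indicat_real U y *\<^sub>R right_deriv f w y"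
    proof eventually_elim
      case (elim y)
      have lim: "(\<lambda>n. y - step n *\<^sub>R v) \<longlonglongrightarrow> y - 0 *\<^sub>R v"
        by (intro tendsto_intros LIMSEQ_inverse_real_of_nat)
      have "\<forall>\<^sub>F n in sequentially. indicat_real U (y - step n *\<^sub>R v) = indicat_real U y"
      proof (cases "y \<in> U")
        case True
        then have "y \<in> interior U" using elim(2) closure_subset by (auto simp: frontier_def)
        then have "\<forall>\<^sub>F n in sequentially. y - step n *\<^sub>R v \<in> interior U"
          using lim by (intro topological_tendstoD[OF lim]) auto
        then show ?thesis
          by eventually_elim (use True interior_subset in \<open>auto simp: indicator_def\<close>)
      next
        case False
        then have "y \<in> - closure U" using elim(2) interior_subset by (auto simp: frontier_def)
        then have "\<forall>\<^sub>F n in sequentially. y - step n *\<^sub>R v \<in> - closure U"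
          using lim by (intro topological_tendstoD[OF lim]) auto
        then show ?thesis
          by eventually_elim (use False closure_subset in \<open>auto simp: indicator_def\<close>)
      qed
      then have "(\<lambda>n. indicat_real U (y - step n *\<^sub>R v)) \<longlonglongrightarrow> indicat_real U y"
        by (rule tendsto_eventually)
      then show ?case using right_derivI(1)[OF elim(1)] by (intro tendsto_scaleR)
    qed
    show "AE y in lborel. norm (?s n y) \<le> indicat_real B y * (L * norm w)" for n
    proof (rule AE_I2)
      fix y
      show "norm (?s n y) \<le> indicat_real B y * (L * norm w)"
      proof (cases "y - step n *\<^sub>R v \<in> U")
        case True
        have "norm y \<le> norm (y - step n *\<^sub>R v) + norm (step n *\<^sub>R v)"
          by (metis norm_triangle_sub add.commute)
        also have "norm (step n *\<^sub>R v) \<le> 1 * norm v"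
          using step1[of n] unfolding norm_scaleR by (intro mult_right_mono) auto
        finally have "y \<in> B" using R(2)[OF True] by (simp add: B_def)
        then show ?thesis using True right_quotient_bound[OF lip, of w y "step n"] by simp
      next
        case False
        then show ?thesis using lipschitz_on_nonneg[OF lip] by simp
      qed
    qed
  qed
  then show ?thesis unfolding shift by (simp add: set_lebesgue_integral_def)
qed

lemma set_integrable_right_deriv:
  assumes "bounded U" "U \<in> sets borel"
  shows "set_integrable lborel U (right_deriv f v)"
  unfolding set_integrable_def
proof (rule integrableI_bounded_set_indicator)
  show "emeasure lborel U < \<infinity>" using assms(1) by (rule emeasure_bounded_finite)
  show "AE x in lborel. x \<in> U \<longrightarrow> norm (right_deriv f v x) \<le> L * norm v"
    using right_deriv_bound_AE[of v] by eventually_elim simp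
qed (use assms in auto)

lemma set_integrable_right_quotient:
  assumes "bounded U" "U \<in> sets borel"
  shows "set_integrable lborel U (\<lambda>x. right_quotient f v (x + y) h)"
  unfolding set_integrable_def
proof (rule integrableI_bounded_set_indicator)
  show "emeasure lborel U < \<infinity>" using assms(1) by (rule emeasure_bounded_finite)
  show "AE x in lborel. x \<in> U \<longrightarrow> norm (right_quotient f v (x + y) h) \<le> L * norm v"
    using right_quotient_bound[OF lip] by simp
qed (use assms in auto)

text \<open>The quotient for \<open>v + w\<close> at x is the one for \<open>v\<close> at x plus the
  one for \<open>w\<close> at x + h v. The shifted term is out of control pointwise but not under an
  integral over a box, and box integrals determine a bounded measurable function a.e.\<close>

lemma right_deriv_add_AE:
  "AE x in lborel. right_deriv f (v + w) x = right_deriv f v x + right_deriv f w x"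
proof -
  let ?g = "\<lambda>x. right_deriv f (v + w) x - (right_deriv f v x + right_deriv f w x)"
  have "AE x in lborel. ?g x = 0"
  proof (rule AE_zero_if_box_integrals_zero)
    show "?g \<in> borel_measurable borel" by measurable
    show "AE x in lborel. \<bar>?g x\<bar> \<le> L * norm (v + w) + L * norm v + L * norm w"
      using right_deriv_bound_AE[of v] right_deriv_bound_AE[of w] right_deriv_bound_AE[of "v + w"]
      by eventually_elim linarith
    fix a b :: 'a
    let ?U = "box a b"
    have U: "bounded ?U" "?U \<in> sets borel" "negligible (frontier ?U)"
      by (auto simp: negligible_convex_frontier)
    note lim = integral_shifted_right_quotient_tendsto[OF U]
    note int = set_integrable_right_deriv[OF U(1,2)]
    note int_q = set_integrable_right_quotient[OF U(1,2)]
    \<comment> \<open>The zero shifts give all three terms the shape of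
      \<open>integral_shifted_right_quotient_tendsto\<close>.\<close>
    have "right_quotient f (v + w) (x + step n *\<^sub>R 0) (step n) =
        right_quotient f w (x + step n *\<^sub>R v) (step n) + right_quotient f v (x + step n *\<^sub>R 0) (step n)" for x n
      by (simp add: right_quotient_def scaleR_add_right add.assoc flip: add_divide_distrib)
    then have "(\<integral>x\<in>?U. right_quotient f (v + w) (x + step n *\<^sub>R 0) (step n) \<partial>lborel) =
        (\<integral>x\<in>?U. right_quotient f w (x + step n *\<^sub>R v) (step n) \<partial>lborel) +
        (\<integral>x\<in>?U. right_quotient f v (x + step n *\<^sub>R 0) (step n) \<partial>lborel)" for n
      by (simp only: set_integral_add(2)[OF int_q int_q])
    then have "(\<lambda>n. \<integral>x\<in>?U. right_quotient f (v + w) (x + step n *\<^sub>R 0) (step n) \<partial>lborel)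
        \<longlonglongrightarrow> (\<integral>x\<in>?U. right_deriv f w x \<partial>lborel) + (\<integral>x\<in>?U. right_deriv f v x \<partial>lborel)"
      by (simp only:) (intro tendsto_add lim)
    then have "(\<integral>x\<in>?U. right_deriv f (v + w) x \<partial>lborel) =
        (\<integral>x\<in>?U. right_deriv f w x \<partial>lborel) + (\<integral>x\<in>?U. right_deriv f v x \<partial>lborel)"
      using lim LIMSEQ_unique by blast
    then show "(\<integral>x\<in>?U. ?g x \<partial>lborel) = 0"
      by (simp add: set_integral_diff(2) set_integral_add int)
  qed
  then show ?thesis by eventually_elim simp
qed

lemma right_deriv_nonneg_scaleR_AE:
  assumes "c \<ge> 0"
  shows "AE x in lborel. right_deriv f (c *\<^sub>R v) x = c * right_deriv f v x"
  using right_deriv_tendsto_AE[of v]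
proof eventually_elim
  case (elim x)
  show ?case
  proof (cases "c = 0")
    case True
    have "right_quotient f 0 x = (\<lambda>_. 0)" by (simp add: right_quotient_def fun_eq_iff)
    then have "(right_quotient f 0 x \<longlongrightarrow> 0) (at_right 0)" by simp
    then show ?thesis using True right_derivI(2) by force
  next
    case False
    with assms have "c > 0" by simp
    have "filterlim (\<lambda>h. c * h) (at_right 0) (at_right 0)"
      using filterlim_times_pos[of "\<lambda>h. h" 0 "at_right 0" c 0] \<open>c > 0\<close> by (simp add: filterlim_ident)
    then have "((\<lambda>h. c * right_quotient f v x (c * h)) \<longlongrightarrow> c * right_deriv f v x) (at_right 0)"
      by (intro tendsto_mult_left filterlim_compose[OF elim])
    moreover have "c * right_quotient f v x (c * h) = right_quotient f (c *\<^sub>R v) x h" for h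
      using False by (simp add: right_quotient_def mult.commute[of h])
    ultimately show ?thesis by (simp add: right_derivI(2))
  qed
qed

text \<open>A negative factor cannot be absorbed into \<open>h > 0\<close>; it is obtained from
  additivity applied to c v + (-c) v = 0. Here the one-sided derivatives become two-sided.\<close>

lemma right_deriv_scaleR_AE: "AE x in lborel. right_deriv f (c *\<^sub>R v) x = c * right_deriv f v x"
proof (cases "c \<ge> 0")
  case True
  then show ?thesis by (rule right_deriv_nonneg_scaleR_AE)
next
  case False
  then have "AE x in lborel. right_deriv f ((- c) *\<^sub>R v) x = (- c) * right_deriv f v x"
    by (intro right_deriv_nonneg_scaleR_AE) simp
  moreover have "AE x in lborel. right_deriv f (c *\<^sub>R v + (- c) *\<^sub>R v) x =
      right_deriv f (c *\<^sub>R v) x + right_deriv f ((- c) *\<^sub>R v) x"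
    by (rule right_deriv_add_AE)
  moreover have "AE x in lborel. right_deriv f (0 *\<^sub>R v) x = 0 * right_deriv f v x"
    by (rule right_deriv_nonneg_scaleR_AE) simp
  ultimately show ?thesis by eventually_elim simp
qed

lemma right_deriv_linear_AE:
  "AE x in lborel. right_deriv f v x = (\<Sum>b\<in>Basis. (v \<bullet> b) * right_deriv f b x)"
proof -
  have "AE x in lborel. right_deriv f (\<Sum>b\<in>S. (v \<bullet> b) *\<^sub>R b) x = (\<Sum>b\<in>S. (v \<bullet> b) * right_deriv f b x)"
    if "finite S" for S
    using that
  proof (induction S)
    case empty
    show ?case using right_deriv_scaleR_AE[of 0 0] by simp
  next
    case (insert b S)
    note insert.IH
    moreover have "AE x in lborel. right_deriv f ((v \<bullet> b) *\<^sub>R b + (\<Sum>b\<in>S. (v \<bullet> b) *\<^sub>R b)) x =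
        right_deriv f ((v \<bullet> b) *\<^sub>R b) x + right_deriv f (\<Sum>b\<in>S. (v \<bullet> b) *\<^sub>R b) x"
      by (rule right_deriv_add_AE)
    moreover note right_deriv_scaleR_AE[of "v \<bullet> b" b]
    ultimately show ?case by eventually_elim (simp add: insert.hyps)
  qed
  from this[OF finite_Basis] show ?thesis by (simp add: euclidean_representation)
qed

end

text \<open>Finitely many directions from \<open>D\<close> form a fine net of the compact unit
  sphere. Convergence along them is uniform, and Lipschitz continuity carries it over to all
  directions. One-sided limits suffice, since y = x + t w with t = |y - x| > 0.\<close>

lemma has_derivative_if_dense_directions:
  fixes f :: "'a::euclidean_space \<Rightarrow> real"
  assumes lip: "L-lipschitz_on UNIV f" and D: "closure D = UNIV" and "bounded_linear g"
    and dir: "\<And>v. v \<in> D \<Longrightarrow> (right_quotient f v x \<longlongrightarrow> g v) (at_right 0)"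
  shows "(f has_derivative g) (at x)"
  unfolding has_derivative_at_alt
proof (intro conjI allI impI)
  show "bounded_linear g" by fact
  then obtain K where K: "K > 0" "\<And>v. \<bar>g v\<bar> \<le> norm v * K"
    using bounded_linear.pos_bounded by force
  have L: "L \<ge> 0" using lip by (rule lipschitz_on_nonneg)
  fix e :: real assume "e > 0"
  \<comment> \<open>Relative to the distance, the errors are \<epsilon> for the quotient along the
    net direction, K \<epsilon> for exchanging the direction in \<open>g\<close>, and L \<epsilon>
    for exchanging it in \<open>f\<close>.\<close>
  define \<epsilon> where "\<epsilon> = e / (1 + K + L)"
  have \<epsilon>: "\<epsilon> > 0" "(1 + K + L) * \<epsilon> = e" using \<open>e > 0\<close> K(1) L by (auto simp: \<epsilon>_def)
  have "sphere 0 1 \<subseteq> (\<Union>v\<in>D. ball v \<epsilon>)"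
  proof
    fix w :: 'a
    have "w \<in> closure D" using D by simp
    then show "w \<in> (\<Union>v\<in>D. ball v \<epsilon>)" using \<epsilon>(1) by (auto simp: closure_approachable)
  qed
  then obtain C where C: "C \<subseteq> D" "finite C" "sphere 0 1 \<subseteq> (\<Union>v\<in>C. ball v \<epsilon>)"
    using compactE_image[OF compact_sphere, of D "\<lambda>v. ball v \<epsilon>" 0 1] by auto
  have "\<forall>\<^sub>F h in at_right 0. \<forall>v\<in>C. \<bar>right_quotient f v x h - g v\<bar> < \<epsilon>"
  proof (intro eventually_ball_finite ballI \<open>finite C\<close>)
    fix v assume "v \<in> C"
    then have "(right_quotient f v x \<longlongrightarrow> g v) (at_right 0)" using dir C(1) by blast
    then show "\<forall>\<^sub>F h in at_right 0. \<bar>right_quotient f v x h - g v\<bar> < \<epsilon>"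
      using \<epsilon>(1) by (simp add: tendsto_iff dist_real_def)
  qed
  then obtain d where d: "d > 0" "\<And>h v. 0 < h \<Longrightarrow> h < d \<Longrightarrow> v \<in> C \<Longrightarrow> \<bar>right_quotient f v x h - g v\<bar> < \<epsilon>"
    unfolding eventually_at_right_field by blast
  have "norm (f y - f x - g (y - x)) \<le> e * norm (y - x)" if "norm (y - x) < d" for y
  proof (cases "y = x")
    case True
    then show ?thesis using \<open>bounded_linear g\<close> by (simp add: linear_simps)
  next
    case False
    define t where "t = norm (y - x)"
    define w where "w = (1 / t) *\<^sub>R (y - x)"
    have t: "0 < t" "t < d" using False that by (auto simp: t_def)
    have y: "y = x + t *\<^sub>R w" using t by (simp add: w_def)
    have "norm w = 1" using t by (simp add: w_def t_def)
    then have "w \<in> sphere 0 1" by simp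
    then have "w \<in> (\<Union>v\<in>C. ball v \<epsilon>)" using C(3) by blast
    then obtain v where v: "v \<in> C" "norm (v - w) < \<epsilon>" by (auto simp: dist_norm)
    have "\<bar>(f (x + t *\<^sub>R v) - f x) / t - g v\<bar> * t \<le> \<epsilon> * t"
      using d(2)[OF t v(1)] t by (intro mult_right_mono) (auto simp: right_quotient_def)
    also have "\<bar>(f (x + t *\<^sub>R v) - f x) / t - g v\<bar> * t = \<bar>((f (x + t *\<^sub>R v) - f x) / t - g v) * t\<bar>"
      using t by (simp add: abs_mult)
    also have "((f (x + t *\<^sub>R v) - f x) / t - g v) * t = f (x + t *\<^sub>R v) - f x - t * g v"
      using t by (simp add: field_simps)
    finally have 1: "\<bar>f (x + t *\<^sub>R v) - f x - t * g v\<bar> \<le> \<epsilon> * t" .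
    have "\<bar>f y - f (x + t *\<^sub>R v)\<bar> \<le> L * (t * norm (v - w))"
      using lipschitz_onD[OF lip, of y "x + t *\<^sub>R v"] t
      by (simp add: dist_norm y norm_minus_commute[of w v] flip: scaleR_diff_right)
    also have "\<dots> \<le> L * (t * \<epsilon>)" using t v L by (intro mult_left_mono) auto
    finally have 2: "\<bar>f y - f (x + t *\<^sub>R v)\<bar> \<le> L * (t * \<epsilon>)" .
    have "\<bar>t * g v - g (y - x)\<bar> = t * \<bar>g (v - w)\<bar>"
      using \<open>bounded_linear g\<close> t by (simp add: y linear_simps abs_mult flip: right_diff_distrib)
    also have "\<dots> \<le> t * (norm (v - w) * K)" using K(2) t by (intro mult_left_mono) auto
    also have "\<dots> \<le> t * (\<epsilon> * K)" using K(1) v t by (intro mult_left_mono mult_right_mono) auto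
    finally have 3: "\<bar>t * g v - g (y - x)\<bar> \<le> t * (\<epsilon> * K)" .
    have "\<bar>f y - f x - g (y - x)\<bar> \<le> ((1 + K + L) * \<epsilon>) * t"
      using 1 2 3 by (simp add: algebra_simps abs_le_iff)
    then show ?thesis using \<epsilon>(2) by (simp add: t_def)
  qed
  then show "\<exists>d>0. \<forall>y. norm (y - x) < d \<longrightarrow> norm (f y - f x - g (y - x)) \<le> e * norm (y - x)"
    using d(1) by blast
qed

text \<open>With countably many dense directions a single null set can be discarded; elsewhere all
  derivatives in these directions exist and are values of one linear map.\<close>

lemma lipschitz_has_derivative_AE:
  fixes f :: "'a::euclidean_space \<Rightarrow> real"
  assumes lip: "L-lipschitz_on UNIV f"
  shows "AE x in lborel. (f has_derivative (\<lambda>v. \<Sum>b\<in>Basis. (v \<bullet> b) * right_deriv f b x)) (at x)"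
proof -
  obtain D :: "'a set" where D: "countable D" "closure D = UNIV"
    by (metis separable[of "UNIV :: 'a set"] top.extremum_uniqueI)
  have "AE x in lborel. \<forall>v\<in>D. (right_quotient f v x \<longlongrightarrow> right_deriv f v x) (at_right 0)"
    using D(1) right_deriv_tendsto_AE[OF lip] by (simp add: AE_ball_countable)
  moreover have "AE x in lborel. \<forall>v\<in>D. right_deriv f v x = (\<Sum>b\<in>Basis. (v \<bullet> b) * right_deriv f b x)"
    using D(1) right_deriv_linear_AE[OF lip] by (simp add: AE_ball_countable)
  ultimately show ?thesis
  proof eventually_elim
    case (elim x)
    show ?case
      by (rule has_derivative_if_dense_directions[OF lip D(2)])
        (use elim in \<open>auto intro!: bounded_linear_intros\<close>)
  qed
qed

theorem rademacher:
  fixes F :: "'a::euclidean_space \<Rightarrow> 'b::euclidean_space"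
  assumes lip: "L-lipschitz_on UNIV F"
  shows "AE x in lborel. F differentiable (at x)"
proof -
  have "L-lipschitz_on UNIV (\<lambda>x. F x \<bullet> b)" if "b \<in> Basis" for b
  proof (rule lipschitz_onI)
    fix x y
    have "\<bar>(F x - F y) \<bullet> b\<bar> \<le> norm (F x - F y)" using that by (rule Basis_le_norm)
    also have "\<dots> \<le> L * dist x y" using lipschitz_onD[OF lip, of x y] by (simp add: dist_norm)
    finally show "dist (F x \<bullet> b) (F y \<bullet> b) \<le> L * dist x y"
      by (simp add: dist_real_def inner_diff_left)
  qed (rule lipschitz_on_nonneg[OF lip])
  then have "AE x in lborel. (\<lambda>x. F x \<bullet> b) differentiable (at x)" if "b \<in> Basis" for b
    using lipschitz_has_derivative_AE[of L "\<lambda>x. F x \<bullet> b"] that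
    by (auto intro: differentiableI elim!: eventually_mono)
  then have "AE x in lborel. \<forall>b\<in>Basis. (\<lambda>x. F x \<bullet> b) differentiable (at x)"
    by (intro AE_finite_allI finite_Basis)
  then show ?thesis
    by eventually_elim (subst differentiable_componentwise_within, simp)
qed

text \<open>The increment is averaged over a ball, so that the derivative bound is only needed almost
  everywhere and no information on individual lines is required.\<close>

lemma increment_le_if_derivative_le_AE:
  fixes f :: "'a::euclidean_space \<Rightarrow> real"
  assumes lip: "L-lipschitz_on UNIV f" and le: "AE x in lborel. right_deriv f v x \<le> d"
    and "s \<ge> 0"
  shows "f (x + s *\<^sub>R v) - f x \<le> s * d"
proof (rule ccontr)
  assume "\<not> f (x + s *\<^sub>R v) - f x \<le> s * d"
  then have gt: "s * d < f (x + s *\<^sub>R v) - f x" by simp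
  have cont: "continuous_on UNIV f" using lip by (rule lipschitz_on_continuous_on)
  have "open {y. s * d < f (y + s *\<^sub>R v) - f y}"
    by (intro open_Collect_less continuous_intros continuous_on_compose2[OF cont] subset_UNIV)
  with gt obtain r where r: "r > 0" "cball x r \<subseteq> {y. s * d < f (y + s *\<^sub>R v) - f y}"
    using open_contains_cball by blast
  define V where "V = measure lborel (cball x r)"
  have V: "V > 0" using r(1) by (simp add: V_def content_cball_pos)
  have V_shift: "measure lborel (cball y r) = V" for y :: 'a
    unfolding V_def by (simp add: content_cball r(1) less_imp_le)
  have fin: "emeasure lborel (cball y r) < \<infinity>" for y :: 'a
    by (intro emeasure_bounded_finite) simp
  have int: "set_integrable lborel (cball y r) g" if "continuous_on UNIV g" for g :: "'a \<Rightarrow> real" and y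
    unfolding set_integrable_def
    by (rule borel_integrable_compact[OF compact_cball continuous_on_subset[OF that subset_UNIV]])
  have cont_shift: "continuous_on UNIV (\<lambda>y. f (y + w))" for w
    by (intro continuous_on_compose2[OF cont] continuous_intros) auto
  have const: "set_integrable lborel (cball y r) (\<lambda>_. c :: real)"
      "(\<integral>z\<in>cball y r. c \<partial>lborel) = c * V" for c and y :: 'a
    using fin[of y] V_shift[of y]
    by (simp_all add: set_integrable_def set_lebesgue_integral_def less_top)
  \<comment> \<open>This integrates \<open>f\<close> over the ball moved along \<open>v\<close>.
    Along \<open>step\<close>, its difference quotients converge to the integral of
    \<open>right_deriv f v\<close> over the moved ball, which is at most
    \<open>d * V\<close>.\<close>
  define \<Phi> where "\<Phi> t = (\<integral>y\<in>cball x r. f (y + t *\<^sub>R v) \<partial>lborel)" for t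
  have \<Phi>_diff: "\<Phi> t - \<Phi> u = (\<integral>y\<in>cball x r. f (y + t *\<^sub>R v) - f (y + u *\<^sub>R v) \<partial>lborel)" for t u
    unfolding \<Phi>_def by (rule set_integral_diff(2)[symmetric]) (intro int cont_shift)+
  have \<Phi>_le: "\<Phi> t - \<Phi> u \<le> L * norm v * V * dist t u" for t u
  proof -
    have "\<Phi> t - \<Phi> u \<le> (\<integral>y\<in>cball x r. L * norm v * dist t u \<partial>lborel)"
      unfolding \<Phi>_diff
    proof (rule set_integral_mono[OF _ const(1)])
      show "set_integrable lborel (cball x r) (\<lambda>y. f (y + t *\<^sub>R v) - f (y + u *\<^sub>R v))"
        by (intro int continuous_intros cont_shift)
      fix y
      have "dist (f (y + t *\<^sub>R v)) (f (y + u *\<^sub>R v)) \<le> L * dist (y + t *\<^sub>R v) (y + u *\<^sub>R v)"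
        using lipschitz_onD[OF lip] by blast
      then show "f (y + t *\<^sub>R v) - f (y + u *\<^sub>R v) \<le> L * norm v * dist t u"
        by (simp add: dist_norm mult_ac flip: scaleR_diff_left)
    qed
    then show ?thesis by (simp add: const(2) mult_ac)
  qed
  have "(L * norm v * V)-lipschitz_on UNIV \<Phi>"
  proof (rule lipschitz_onI)
    show "dist (\<Phi> t) (\<Phi> u) \<le> L * norm v * V * dist t u" for t u
      using \<Phi>_le[of t u] \<Phi>_le[of u t] by (simp add: dist_commute[of u t]) (simp add: dist_real_def)
    show "0 \<le> L * norm v * V"
      by (intro mult_nonneg_nonneg norm_ge_zero lipschitz_on_nonneg[OF lip] less_imp_le[OF V])
  qed
  then have cont_\<Phi>: "continuous_on UNIV \<Phi>" by (rule lipschitz_on_continuous_on)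
  have shift: "(\<integral>y\<in>cball x r. g (y + w) \<partial>lborel) = (\<integral>y\<in>cball (x + w) r. g y \<partial>lborel)"
    if "g \<in> borel_measurable borel" for g :: "'a \<Rightarrow> real" and w
  proof -
    note that [measurable]
    have [measurable]: "cball (x + w) r \<in> sets borel" by simp
    have "(\<integral>y\<in>cball (x + w) r. g y \<partial>lborel)
        = (\<integral>y. indicator (cball (x + w) r) y *\<^sub>R g y \<partial>distr lborel borel ((+) w))"
      by (simp only: lborel_distr_plus set_lebesgue_integral_def)
    also have "\<dots> = (\<integral>y. indicator (cball (x + w) r) (w + y) *\<^sub>R g (w + y) \<partial>lborel)"
      by (rule integral_distr) measurable
    also have "\<dots> = (\<integral>y. indicat_real (cball x r) y *\<^sub>R g (y + w) \<partial>lborel)"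
    proof (rule Bochner_Integration.integral_cong[OF refl])
      fix y
      have "dist (x + w) (w + y) = dist x y" by (simp add: dist_norm algebra_simps)
      then show "indicator (cball (x + w) r) (w + y) *\<^sub>R g (w + y) = indicat_real (cball x r) y *\<^sub>R g (y + w)"
        by (simp add: indicator_def add.commute)
    qed
    finally show ?thesis by (simp only: set_lebesgue_integral_def)
  qed
  \<comment> \<open>The slack \<open>e\<close> makes the bound on the limit of the quotients strict,
    so some quotient of the sequence already satisfies it.\<close>
  have le_eps: "\<Phi> s - \<Phi> 0 \<le> s * (d + e) * V" if "e > 0" for e
  proof -
    have "0 * (d + e) * V - \<Phi> 0 \<le> s * (d + e) * V - \<Phi> s"
    proof (rule le_if_locally_not_decreasing[OF \<open>s \<ge> 0\<close>])
      show "continuous_on {0..s} (\<lambda>t. t * (d + e) * V - \<Phi> t)"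
        by (intro continuous_intros continuous_on_subset[OF cont_\<Phi>]) auto
      fix t assume t: "0 \<le> t" "t < s"
      let ?U = "cball (x + t *\<^sub>R v) r"
      have U: "bounded ?U" "?U \<in> sets borel" "negligible (frontier ?U)"
        by (simp_all add: negligible_sphere)
      have "(\<integral>y\<in>?U. right_quotient f v y h \<partial>lborel) = (\<Phi> (t + h) - \<Phi> t) / h" for h
      proof -
        have "(\<integral>y\<in>?U. right_quotient f v y h \<partial>lborel)
            = (\<integral>y\<in>cball x r. right_quotient f v (y + t *\<^sub>R v) h \<partial>lborel)"
          by (rule shift[symmetric]) (rule borel_measurable_right_quotient[OF lip])
        also have "\<dots> = (\<integral>y\<in>cball x r. f (y + (t + h) *\<^sub>R v) - f (y + t *\<^sub>R v) \<partial>lborel) / h"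
          by (simp add: right_quotient_def scaleR_add_left add.assoc)
        finally show ?thesis unfolding \<Phi>_diff .
      qed
      then have lim: "(\<lambda>n. (\<Phi> (t + step n) - \<Phi> t) / step n) \<longlonglongrightarrow> (\<integral>y\<in>?U. right_deriv f v y \<partial>lborel)"
        using integral_shifted_right_quotient_tendsto[OF lip U, of v 0] by simp
      have "(\<integral>y\<in>?U. right_deriv f v y \<partial>lborel) \<le> (\<integral>y\<in>?U. d \<partial>lborel)"
        by (rule set_integral_mono_AE[OF set_integrable_right_deriv[OF lip U(1,2)] const(1)])
          (use le in auto)
      also have "\<dots> < (d + e) * V" using V that by (simp add: const(2))
      finally have "\<forall>\<^sub>F n in sequentially. (\<Phi> (t + step n) - \<Phi> t) / step n < (d + e) * V"
        using lim by (rule order_tendstoD(2)[rotated])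
      moreover have "\<forall>\<^sub>F n in sequentially. step n < s - t"
        using LIMSEQ_inverse_real_of_nat t by (intro order_tendstoD(2)) auto
      ultimately have "\<forall>\<^sub>F n in sequentially. (\<Phi> (t + step n) - \<Phi> t) / step n < (d + e) * V \<and> step n < s - t"
        by eventually_elim simp
      then obtain n where n: "(\<Phi> (t + step n) - \<Phi> t) / step n < (d + e) * V" "step n < s - t"
        using eventually_happens'[OF sequentially_bot] by blast
      then have "\<Phi> (t + step n) - \<Phi> t \<le> (d + e) * V * step n" by (simp add: pos_divide_less_eq)
      then show "\<exists>y>t. y \<le> s \<and> t * (d + e) * V - \<Phi> t \<le> y * (d + e) * V - \<Phi> y"
      proof (intro exI[of _ "t + step n"] conjI)
        show "t * (d + e) * V - \<Phi> t \<le> (t + step n) * (d + e) * V - \<Phi> (t + step n)"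
          using \<open>\<Phi> (t + step n) - \<Phi> t \<le> (d + e) * V * step n\<close> by (simp only: algebra_simps)
      qed (use n(2) in simp_all)
    qed
    then show ?thesis by simp
  qed
  have "\<Phi> s - \<Phi> 0 \<le> s * d * V + e" if "e > 0" for e
  proof (cases "s = 0")
    case True
    then show ?thesis using that by simp
  next
    case False
    then show ?thesis using le_eps[of "e / (s * V)"] \<open>s \<ge> 0\<close> V that by (simp add: algebra_simps)
  qed
  then have upper: "\<Phi> s - \<Phi> 0 \<le> s * d * V" by (rule field_le_epsilon)
  have cont_incr: "continuous_on UNIV (\<lambda>y. f (y + s *\<^sub>R v) - f y)"
    by (intro continuous_on_diff cont_shift cont)
  \<comment> \<open>The minimiser over the compact ball turns the strict pointwise inequality into a
    uniform gap, which survives integration.\<close>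
  obtain z where z: "z \<in> cball x r" "\<And>y. y \<in> cball x r \<Longrightarrow> f (z + s *\<^sub>R v) - f z \<le> f (y + s *\<^sub>R v) - f y"
    using continuous_attains_inf[OF compact_cball _ continuous_on_subset[OF cont_incr subset_UNIV], of x r] r(1)
    by auto
  have "s * d * V < (f (z + s *\<^sub>R v) - f z) * V"
    using z(1) r(2) V by (intro mult_strict_right_mono) auto
  also have "\<dots> = (\<integral>y\<in>cball x r. f (z + s *\<^sub>R v) - f z \<partial>lborel)"
    by (simp only: const(2))
  also have "\<dots> \<le> (\<integral>y\<in>cball x r. f (y + s *\<^sub>R v) - f y \<partial>lborel)"
    by (rule set_integral_mono[OF const(1) int[OF cont_incr] z(2)])
  also have "\<dots> = \<Phi> s - \<Phi> 0" using \<Phi>_diff[of s 0] by (simp only: scaleR_zero_left add_0_right)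
  finally show False using upper by simp
qed

subsection \<open>Norms, expansive maps and the Krasnoselskii iteration\<close>

locale vector_norm =
  fixes N :: "'a::euclidean_space \<Rightarrow> real"
  assumes N_scaleR: "N (c *\<^sub>R x) = \<bar>c\<bar> * N x"
    and N_triangle: "N (x + y) \<le> N x + N y"
    and N_pos: "x \<noteq> 0 \<Longrightarrow> 0 < N x"
begin

lemma N_zero [simp]: "N 0 = 0"
  using N_scaleR[of 0 0] by simp

lemma N_nonneg [simp]: "0 \<le> N x"
  using N_pos[of x] by (cases "x = 0") auto

lemma N_eq_zero_iff [simp]: "N x = 0 \<longleftrightarrow> x = 0"
  using N_pos[of x] by (cases "x = 0") auto

lemma N_minus: "N (- x) = N x"
  using N_scaleR[of "- 1" x] by simp

lemma N_minus_commute: "N (x - y) = N (y - x)"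
  using N_minus[of "x - y"] by simp

lemma N_triangle_diff: "N (x - z) \<le> N (x - y) + N (y - z)"
  using N_triangle[of "x - y" "y - z"] by simp

lemma upper_bound_norm:
  obtains C where "C > 0" "\<And>x. N x \<le> C * norm x"
proof
  let ?C = "1 + (\<Sum>b\<in>Basis. N b)"
  show "?C > 0" by (simp add: add_pos_nonneg sum_nonneg)
  fix x :: 'a
  have sum: "N (\<Sum>b\<in>S. (x \<bullet> b) *\<^sub>R b) \<le> (\<Sum>b\<in>S. \<bar>x \<bullet> b\<bar> * N b)" if "finite S" for S
    using that
  proof (induction S)
    case (insert b S)
    then show ?case
      using N_triangle[of "(x \<bullet> b) *\<^sub>R b" "\<Sum>b\<in>S. (x \<bullet> b) *\<^sub>R b"] by (simp add: N_scaleR)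
  qed simp
  have "N x = N (\<Sum>b\<in>Basis. (x \<bullet> b) *\<^sub>R b)" by (simp add: euclidean_representation)
  also have "\<dots> \<le> (\<Sum>b\<in>Basis. \<bar>x \<bullet> b\<bar> * N b)" by (rule sum) simp
  also have "\<dots> \<le> (\<Sum>b\<in>Basis. norm x * N b)"
    by (intro sum_mono mult_right_mono Basis_le_norm) auto
  also have "\<dots> = norm x * (\<Sum>b\<in>Basis. N b)" by (simp only: sum_distrib_left)
  also have "\<dots> \<le> ?C * norm x" by (simp add: distrib_left mult.commute)
  finally show "N x \<le> ?C * norm x" .
qed

lemma continuous_on_N: "continuous_on UNIV N"
proof -
  obtain C where C: "C > 0" "\<And>x. N x \<le> C * norm x" using upper_bound_norm by blast
  have "C-lipschitz_on UNIV N"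
  proof (rule lipschitz_onI)
    fix x y
    have "N x - N y \<le> N (x - y)" "N y - N x \<le> N (y - x)"
      using N_triangle[of "x - y" y] N_triangle[of "y - x" x] by auto
    then show "dist (N x) (N y) \<le> C * dist x y"
      using C(2)[of "x - y"] by (simp add: N_minus_commute[of y x] dist_norm)
  qed (use C in simp)
  then show ?thesis by (rule lipschitz_on_continuous_on)
qed

text \<open>The constant is the minimum of \<open>N\<close> on the unit sphere, attained by
  compactness.\<close>

lemma lower_bound_norm:
  obtains c where "c > 0" "\<And>x. c * norm x \<le> N x"
proof -
  obtain b :: 'a where "b \<in> Basis" using nonempty_Basis by blast
  then have "sphere (0::'a) 1 \<noteq> {}" by (auto simp: intro!: exI[of _ b])
  then obtain z :: 'a where z: "norm z = 1" "\<And>y. norm y = 1 \<Longrightarrow> N z \<le> N y"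
    using continuous_attains_inf[OF compact_sphere _ continuous_on_subset[OF continuous_on_N subset_UNIV], of 0 1]
    by auto
  show thesis
  proof
    show "N z > 0" using z(1) by (intro N_pos) auto
    fix x :: 'a
    show "N z * norm x \<le> N x"
    proof (cases "x = 0")
      case False
      then have "N z \<le> N ((1 / norm x) *\<^sub>R x)" by (intro z(2)) simp
      then show ?thesis using False by (simp add: N_scaleR field_simps)
    qed simp
  qed
qed

lemma tendsto_if_N_tendsto_zero:
  assumes "((\<lambda>k. N (f k - z)) \<longlongrightarrow> 0) F"
  shows "(f \<longlongrightarrow> z) F"
proof -
  obtain c where c: "c > 0" "\<And>x. c * norm x \<le> N x" using lower_bound_norm by blast
  have "((\<lambda>k. f k - z) \<longlongrightarrow> 0) F"
  proof (rule Lim_null_comparison)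
    show "\<forall>\<^sub>F k in F. norm (f k - z) \<le> N (f k - z) / c"
      using c by (simp add: pos_le_divide_eq mult.commute)
    show "((\<lambda>k. N (f k - z) / c) \<longlongrightarrow> 0) F"
      using tendsto_divide[OF assms tendsto_const[of c]] c(1) by simp
  qed
  then show ?thesis by (simp add: LIM_zero_iff)
qed

lemma N_tendsto: "(f \<longlongrightarrow> z) F \<Longrightarrow> ((\<lambda>k. N (f k)) \<longlongrightarrow> N z) F"
  by (rule continuous_on_tendsto_compose[OF continuous_on_N _ UNIV_I]) simp_all

text \<open>Invariance of domain makes the range open. It is closed because the inverse is
  Lipschitz, so the preimages of a convergent sequence are Cauchy; connectedness does the rest. The
  case \<open>k = 1\<close> yields the resolvent, \<open>k = c\<close> the zero of
  \<open>F + G\<close>.\<close>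

lemma bij_if_expansive:
  fixes \<Phi> :: "'a \<Rightarrow> 'a"
  assumes cont: "continuous_on UNIV \<Phi>" and "k > 0"
    and expansive: "\<And>x y. k * N (x - y) \<le> N (\<Phi> x - \<Phi> y)"
  shows "bij \<Phi>"
proof -
  have inj: "inj \<Phi>"
  proof (rule injI)
    fix x y assume "\<Phi> x = \<Phi> y"
    then have "k * N (x - y) \<le> 0" using expansive[of x y] by simp
    then have "N (x - y) \<le> 0" using \<open>k > 0\<close> by (simp add: mult_le_0_iff)
    then have "N (x - y) = 0" using N_nonneg[of "x - y"] by linarith
    then show "x = y" by simp
  qed
  have "open (range \<Phi>)" by (rule invariance_of_domain[OF cont open_UNIV inj])
  moreover have "closed (range \<Phi>)"
    unfolding closed_sequential_limits
  proof (intro allI impI, elim conjE)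
    fix X l assume X: "\<forall>n. X n \<in> range \<Phi>" "X \<longlonglongrightarrow> l"
    define w where "w n = inv \<Phi> (X n)" for n
    have w: "X n = \<Phi> (w n)" for n using X(1) by (simp add: w_def f_inv_into_f)
    obtain c where c: "c > 0" "\<And>x. c * norm x \<le> N x" using lower_bound_norm by blast
    obtain C where C: "C > 0" "\<And>x. N x \<le> C * norm x" using upper_bound_norm by blast
    have le: "norm (x - y) \<le> C / (k * c) * norm (\<Phi> x - \<Phi> y)" for x y
    proof -
      have "k * (c * norm (x - y)) \<le> k * N (x - y)" using c \<open>k > 0\<close> by (intro mult_left_mono) auto
      also have "\<dots> \<le> N (\<Phi> x - \<Phi> y)" by (rule expansive)
      also have "\<dots> \<le> C * norm (\<Phi> x - \<Phi> y)" by (rule C)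
      finally show ?thesis using c \<open>k > 0\<close> by (simp add: field_simps)
    qed
    have "Cauchy w"
    proof (rule metric_CauchyI)
      fix e :: real assume "e > 0"
      then have e': "e / (C / (k * c)) > 0" using c C \<open>k > 0\<close> by simp
      have "Cauchy X" using X(2) by (rule LIMSEQ_imp_Cauchy)
      then obtain M where M: "\<And>m n. M \<le> m \<Longrightarrow> M \<le> n \<Longrightarrow> dist (X m) (X n) < e / (C / (k * c))"
        using e' by (blast dest: metric_CauchyD)
      have "dist (w m) (w n) < e" if "M \<le> m" "M \<le> n" for m n
      proof -
        have "dist (w m) (w n) \<le> C / (k * c) * dist (X m) (X n)"
          using le[of "w m" "w n"] by (simp add: dist_norm w)
        also have "\<dots> < C / (k * c) * (e / (C / (k * c)))"
          using M[OF that] c C \<open>k > 0\<close> by (intro mult_strict_left_mono) auto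
        also have "\<dots> = e" using c C \<open>k > 0\<close> by simp
        finally show ?thesis .
      qed
      then show "\<exists>M. \<forall>m\<ge>M. \<forall>n\<ge>M. dist (w m) (w n) < e" by blast
    qed
    then obtain p where "w \<longlonglongrightarrow> p" using Cauchy_convergent convergent_def by blast
    then have "(\<lambda>n. \<Phi> (w n)) \<longlonglongrightarrow> \<Phi> p"
      by (rule continuous_on_tendsto_compose[OF cont _ UNIV_I]) simp
    then have "X \<longlonglongrightarrow> \<Phi> p" by (simp flip: w)
    then have "l = \<Phi> p" using X(2) by (rule LIMSEQ_unique[rotated])
    then show "l \<in> range \<Phi>" by simp
  qed
  ultimately have "range \<Phi> = UNIV" using clopen[of "range \<Phi>"] by auto
  with inj show ?thesis by (simp add: bij_def)
qed

end

section \<open>Averaged iterations of nonexpansive maps\<close>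

locale krasnoselskii = vector_norm N for N :: "'a::euclidean_space \<Rightarrow> real" +
  fixes T :: "'a \<Rightarrow> 'a" and xs :: "nat \<Rightarrow> 'a" and z :: 'a
  assumes nonexpansive: "N (T x - T y) \<le> N (x - y)"
    and fixpoint: "T z = z"
    and iter: "xs (Suc k) = (1/2) *\<^sub>R xs k + (1/2) *\<^sub>R T (xs k)"
begin

definition "residual k = N (T (xs k) - xs k)"

lemma iter_diff: "N (xs (Suc k) - xs k) = residual k / 2"
proof -
  have "xs (Suc k) - xs k = (1/2) *\<^sub>R (T (xs k) - xs k)"
    by (simp add: iter scaleR_diff_right) (simp flip: scaleR_left.add add: algebra_simps)
  then show ?thesis by (simp add: N_scaleR residual_def)
qed

lemma N_to_midpoint: "N (y - xs (Suc k)) \<le> (1/2) * N (y - xs k) + (1/2) * N (y - T (xs k))"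
proof -
  have "y - xs (Suc k) = (1/2) *\<^sub>R (y - xs k) + (1/2) *\<^sub>R (y - T (xs k))"
    by (simp add: iter algebra_simps) (simp flip: scaleR_left.add)
  then show ?thesis using N_triangle[of "(1/2) *\<^sub>R (y - xs k)" "(1/2) *\<^sub>R (y - T (xs k))"]
    by (simp only: N_scaleR)
qed

text \<open>Apply the midpoint inequality to the image of the new iterate: its distances to the two
  old points are at most 3/2 and 1/2 of the old residual, and their mean is exactly the old
  residual.\<close>

lemma residual_Suc_le: "residual (Suc k) \<le> residual k"
proof -
  have "N (T (xs (Suc k)) - xs k) \<le> N (T (xs (Suc k)) - T (xs k)) + residual k"
    unfolding residual_def by (rule N_triangle_diff)
  moreover have "N (T (xs (Suc k)) - T (xs k)) \<le> residual k / 2"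
    using nonexpansive[of "xs (Suc k)" "xs k"] iter_diff[of k] by simp
  ultimately show ?thesis
    using N_to_midpoint[of "T (xs (Suc k))" k] unfolding residual_def[of "Suc k"] by simp
qed

lemma residual_antimono: "i \<le> j \<Longrightarrow> residual j \<le> residual i"
  using residual_Suc_le by (rule lift_Suc_antimono_le)

lemma N_T_diff_le: "N (T (xs (i + n)) - T (xs i)) \<le> real n * residual i / 2"
proof (induction n)
  case (Suc n)
  have "N (T (xs (i + Suc n)) - T (xs (i + n))) \<le> residual (i + n) / 2"
    using nonexpansive[of "xs (i + Suc n)" "xs (i + n)"] iter_diff[of "i + n"] by simp
  also have "\<dots> \<le> residual i / 2" using residual_antimono[of i "i + n"] by simp
  finally show ?case
    using Suc N_triangle_diff[of "T (xs (i + Suc n))" "T (xs i)" "T (xs (i + n))"] by (simp add: field_simps)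
qed simp

text \<open>The Goebel--Kirk inequality. The right-hand side is bounded and, for fixed \<open>n\<close>, the subtracted
  term vanishes as \<open>i\<close> grows, so the limit of the residuals is at most a constant over \<open>n\<close>.\<close>

lemma goebel_kirk:
  "(1 + real n / 2) * residual i - 2 ^ n * (residual i - residual (i + n)) \<le> N (T (xs (i + n)) - xs i)"
proof (induction n arbitrary: i)
  case 0
  then show ?case by (simp add: residual_def)
next
  case (Suc n)
  let ?m = "i + Suc n"
  have "(1 + real n / 2) * residual (Suc i) - 2 ^ n * (residual (Suc i) - residual ?m)
      \<le> N (T (xs ?m) - xs (Suc i))"
    using Suc[of "Suc i"] by simp
  also have "\<dots> \<le> (1/2) * N (T (xs ?m) - xs i) + (1/2) * (real (Suc n) * residual i / 2)"
    using N_to_midpoint[of "T (xs ?m)" i] N_T_diff_le[of i "Suc n"] by simp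
  finally have *: "(2 + real n) * residual (Suc i) - 2 * 2 ^ n * (residual (Suc i) - residual ?m)
      - (real n + 1) * residual i / 2 \<le> N (T (xs ?m) - xs i)"
    by (simp add: field_simps)
  \<comment> \<open>The lower bound just obtained exceeds the claimed one by 2^(n+1) - (n + 2) times
    the drop of the residual at \<open>i\<close>; this estimate makes the coefficient
    nonnegative.\<close>
  have "real n + 2 \<le> 2 * 2 ^ n" by (induction n) auto
  then have "0 \<le> (2 * 2 ^ n - (real n + 2)) * (residual i - residual (Suc i))"
    using residual_Suc_le[of i] by (intro mult_nonneg_nonneg) auto
  with * show ?case by (simp add: field_simps)
qed

lemma N_fixpoint_Suc_le:
  assumes "T p = p"
  shows "N (xs (Suc k) - p) \<le> N (xs k - p)"
  using N_to_midpoint[of p k] nonexpansive[of p "xs k"] assms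
  by (simp add: N_minus_commute[of p])

lemma residual_tendsto_zero: "residual \<longlonglongrightarrow> 0"
proof -
  have "decseq residual" using residual_antimono by (simp add: decseq_def)
  then obtain r where r: "residual \<longlonglongrightarrow> r"
    using decseq_convergent[of residual 0] by (auto simp: residual_def)
  have "r \<ge> 0" using r by (rule LIMSEQ_le_const) (simp add: residual_def)
  \<comment> \<open>The orbit and its image under \<open>T\<close> stay within N (xs 0 - z) of the
    fixed point \<open>z\<close>, so their points are at most twice that far apart.\<close>
  define B where "B = 2 * N (xs 0 - z)"
  have bound: "N (xs k - z) \<le> N (xs 0 - z)" for k
  proof (induction k)
    case (Suc k)
    then show ?case using N_fixpoint_Suc_le[OF fixpoint, of k] by linarith
  qed simp
  have B: "N (T (xs j) - xs i) \<le> B" for i j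
  proof -
    have "N (T (xs j) - xs i) \<le> N (T (xs j) - T z) + N (z - xs i)"
      using N_triangle_diff[of "T (xs j)" "xs i" z] fixpoint by simp
    also have "\<dots> \<le> N (xs j - z) + N (xs i - z)"
      using nonexpansive[of "xs j" z] by (simp add: N_minus_commute[of z])
    also have "\<dots> \<le> B" using bound[of i] bound[of j] by (simp add: B_def)
    finally show ?thesis .
  qed
  have le: "(1 + real n / 2) * r \<le> B" for n
  proof -
    have "(\<lambda>i. residual (i + n)) \<longlonglongrightarrow> r" using r by (rule LIMSEQ_ignore_initial_segment)
    then have "(\<lambda>i. (1 + real n / 2) * residual i - 2 ^ n * (residual i - residual (i + n)))
        \<longlonglongrightarrow> (1 + real n / 2) * r - 2 ^ n * (r - r)"
      using r by (intro tendsto_intros)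
    then have "(1 + real n / 2) * r - 2 ^ n * (r - r) \<le> B"
      by (rule LIMSEQ_le_const2) (use goebel_kirk B order_trans in blast)
    then show ?thesis by simp
  qed
  have "r = 0"
  proof (rule ccontr)
    assume "r \<noteq> 0"
    with \<open>r \<ge> 0\<close> have "r > 0" by simp
    then obtain n :: nat where "2 * B / r < real n" using reals_Archimedean2 by blast
    then show False using le[of n] \<open>r > 0\<close> by (simp add: field_simps)
  qed
  with r show ?thesis by simp
qed

text \<open>A cluster point \<open>p\<close> of the bounded orbit has zero residual, so it is fixed.
  Distances to a fixed point do not increase, and along the subsequence they tend to 0, so the whole
  orbit converges to \<open>p\<close>.\<close>

theorem iteration_converges: "\<exists>p. T p = p \<and> xs \<longlonglongrightarrow> p"
proof -
  obtain c where c: "c > 0" "\<And>x. c * norm x \<le> N x" using lower_bound_norm by blast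
  obtain C where C: "C > 0" "\<And>x. N x \<le> C * norm x" using upper_bound_norm by blast
  have bound: "N (xs k - z) \<le> N (xs 0 - z)" for k
  proof (induction k)
    case (Suc k)
    then show ?case using N_fixpoint_Suc_le[OF fixpoint, of k] by linarith
  qed simp
  have "dist z (xs k) \<le> N (xs 0 - z) / c" for k
    using c(2)[of "xs k - z"] bound[of k] c(1)
    by (simp add: dist_norm norm_minus_commute[of z] pos_le_divide_eq mult.commute)
  then have "range xs \<subseteq> cball z (N (xs 0 - z) / c)" by auto
  then obtain p s where ps: "strict_mono s" "(xs \<circ> s) \<longlonglongrightarrow> p"
    using compact_cball[of z "N (xs 0 - z) / c", unfolded compact_def] by (metis range_subsetD)
  have "continuous_on UNIV T"
  proof -
    have "(C / c)-lipschitz_on UNIV T"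
    proof (rule lipschitz_onI)
      fix x y
      have "c * norm (T x - T y) \<le> C * norm (x - y)"
        using c(2)[of "T x - T y"] nonexpansive[of x y] C(2)[of "x - y"] by linarith
      then show "dist (T x) (T y) \<le> C / c * dist x y" using c(1) by (simp add: dist_norm field_simps)
    qed (use c C in simp)
    then show ?thesis by (rule lipschitz_on_continuous_on)
  qed
  then have "(\<lambda>k. T ((xs \<circ> s) k)) \<longlonglongrightarrow> T p"
    by (rule continuous_on_tendsto_compose[OF _ ps(2) UNIV_I]) simp
  then have "(\<lambda>k. residual (s k)) \<longlonglongrightarrow> N (T p - p)"
    unfolding residual_def using ps(2) by (intro N_tendsto tendsto_diff) (auto simp: o_def)
  moreover have "(\<lambda>k. residual (s k)) \<longlonglongrightarrow> 0"
    using LIMSEQ_subseq_LIMSEQ[OF residual_tendsto_zero ps(1)] by (simp add: o_def)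
  ultimately have "N (T p - p) = 0" using LIMSEQ_unique by blast
  then have p: "T p = p" by simp
  have "decseq (\<lambda>k. N (xs k - p))" using N_fixpoint_Suc_le[OF p] by (rule decseq_SucI)
  then obtain r where r: "(\<lambda>k. N (xs k - p)) \<longlonglongrightarrow> r"
    using decseq_convergent[of "\<lambda>k. N (xs k - p)" 0] by auto
  have "(\<lambda>k. N ((xs \<circ> s) k - p)) \<longlonglongrightarrow> N (p - p)"
    using ps(2) by (intro N_tendsto tendsto_intros)
  moreover have "(\<lambda>k. N ((xs \<circ> s) k - p)) \<longlonglongrightarrow> r"
    using LIMSEQ_subseq_LIMSEQ[OF r ps(1)] by (simp add: o_def)
  ultimately have "r = 0" using LIMSEQ_unique by fastforce
  then have "xs \<longlonglongrightarrow> p" using r by (intro tendsto_if_N_tendsto_zero) simp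
  with p show ?thesis by blast
qed

end

subsection \<open>Monotonicity with respect to weighted norms\<close>

lemma vector_norm_norm1w:
  fixes eta :: "real^'n"
  assumes "\<forall>i. eta $ i > 0"
  shows "vector_norm (norm1w eta)"
proof
  show "norm1w eta (c *\<^sub>R x) = \<bar>c\<bar> * norm1w eta x" for c x
    by (simp add: norm1w_def abs_mult sum_distrib_left mult_ac)
  show "norm1w eta (x + y) \<le> norm1w eta x + norm1w eta y" for x y
    unfolding norm1w_def sum.distrib[symmetric] distrib_left[symmetric] vector_add_component
    using assms by (intro sum_mono mult_left_mono abs_triangle_ineq) (auto intro: less_imp_le)
  fix x :: "real^'n" assume "x \<noteq> 0"
  then obtain i where "x $ i \<noteq> 0" by (metis vec_eq_iff zero_index)
  then show "0 < norm1w eta x"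
    unfolding norm1w_def using assms by (intro sum_pos2[of _ i]) (auto intro!: mult_nonneg_nonneg simp: less_imp_le)
qed

lemma norminfw_bound:
  assumes "\<forall>i. eta $ i > 0"
  shows "\<bar>x $ i\<bar> \<le> norminfw eta x * eta $ i"
proof -
  have "\<bar>x $ i\<bar> / eta $ i \<le> norminfw eta x" unfolding norminfw_def by (rule Max_ge) auto
  then show ?thesis using assms by (simp add: pos_divide_le_eq)
qed

lemma norminfw_attained: "\<exists>i. norminfw eta x = \<bar>x $ i\<bar> / eta $ i"
proof -
  have "norminfw eta x \<in> range (\<lambda>i. \<bar>x $ i\<bar> / eta $ i)" unfolding norminfw_def by (rule Max_in) auto
  then show ?thesis by blast
qed

lemma norminfw_le:
  assumes "\<forall>i. eta $ i > 0" and "\<And>i. \<bar>x $ i\<bar> \<le> M * eta $ i"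
  shows "norminfw eta x \<le> M"
proof -
  obtain i where "norminfw eta x = \<bar>x $ i\<bar> / eta $ i" using norminfw_attained by blast
  then show ?thesis using assms by (simp add: pos_divide_le_eq)
qed

lemma vector_norm_norminfw:
  fixes eta :: "real^'n"
  assumes eta: "\<forall>i. eta $ i > 0"
  shows "vector_norm (norminfw eta)"
proof
  have le: "norminfw eta (c *\<^sub>R x) \<le> \<bar>c\<bar> * norminfw eta x" for c and x :: "real^'n"
    using norminfw_bound[OF eta, of x]
    by (intro norminfw_le[OF eta]) (simp add: abs_mult mult.assoc mult_left_mono)
  have nonneg: "0 \<le> norminfw eta x" for x
    using norminfw_attained[of eta x] eta by (metis abs_ge_zero divide_nonneg_pos)
  show "norminfw eta (c *\<^sub>R x) = \<bar>c\<bar> * norminfw eta x" for c x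
  proof (cases "c = 0")
    case True
    then show ?thesis using le[of 0 x] nonneg[of "0 *\<^sub>R x"] by simp
  next
    case False
    then show ?thesis using le[of c x] le[of "1 / c" "c *\<^sub>R x"] by (simp add: field_simps)
  qed
  show "norminfw eta (x + y) \<le> norminfw eta x + norminfw eta y" for x y
  proof (rule norminfw_le[OF eta])
    show "\<bar>(x + y) $ i\<bar> \<le> (norminfw eta x + norminfw eta y) * eta $ i" for i
      using norminfw_bound[OF eta, of x i] norminfw_bound[OF eta, of y i] by (simp add: distrib_right)
  qed
  fix x :: "real^'n" assume "x \<noteq> 0"
  then obtain i where i: "x $ i \<noteq> 0" by (metis vec_eq_iff zero_index)
  then have "0 < norminfw eta x * eta $ i" using norminfw_bound[OF eta, of x i] by linarith
  then show "0 < norminfw eta x" using eta by (metis zero_less_mult_pos2)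
qed

text \<open>Write d = H x - H y and split x - y into x - y + a d and -a d. Subadditivity of the
  pairing in its first argument fits this split and the sign convention of
  \<open>monotone_wrt\<close>; Cauchy-Schwarz and cancelling one factor \<open>nrm (x - y)\<close>
  give the claim.\<close>

lemma monotone_wrt_expansive:
  assumes "vector_norm nrm" and mono: "monotone_wrt nrm c H" and "a \<ge> 0"
  shows "(1 + a * c) * nrm (x - y) \<le> nrm (x - y + a *\<^sub>R (H x - H y))"
proof -
  interpret vector_norm nrm by fact
  obtain P where P: "compatible_wp nrm P"
      and mono: "\<And>x y. - P (- (H x - H y)) (x - y) \<ge> c * (nrm (x - y))\<^sup>2"
    using mono by (auto simp: monotone_wrt_def)
  let ?u = "x - y" and ?d = "H x - H y"
  have sub: "\<And>x1 x2 y. P (x1 + x2) y \<le> P x1 y + P x2 y"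
    and hom: "\<And>a x y. a \<ge> 0 \<Longrightarrow> P (a *\<^sub>R x) y = a * P x y"
    and cs: "\<And>x y. \<bar>P x y\<bar> \<le> sqrt (P x x) * sqrt (P y y)"
    and sq: "\<And>x. P x x = (nrm x)\<^sup>2"
    using P by (auto simp: compatible_wp_def)
  have "?u = (?u + a *\<^sub>R ?d) + a *\<^sub>R (- ?d)" by (simp add: algebra_simps)
  then have "(nrm ?u)\<^sup>2 = P ((?u + a *\<^sub>R ?d) + a *\<^sub>R (- ?d)) ?u" by (simp only: sq)
  also have "\<dots> \<le> P (?u + a *\<^sub>R ?d) ?u + P (a *\<^sub>R (- ?d)) ?u" by (rule sub)
  also have "P (a *\<^sub>R (- ?d)) ?u = a * P (- ?d) ?u" using \<open>a \<ge> 0\<close> by (rule hom)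
  finally have "(nrm ?u)\<^sup>2 \<le> P (?u + a *\<^sub>R ?d) ?u + a * P (- ?d) ?u" .
  moreover have "a * P (- ?d) ?u \<le> a * (- c * (nrm ?u)\<^sup>2)"
    using mono[of x y] \<open>a \<ge> 0\<close> by (intro mult_left_mono) auto
  moreover have "P (?u + a *\<^sub>R ?d) ?u \<le> nrm (?u + a *\<^sub>R ?d) * nrm ?u"
    using cs[of "?u + a *\<^sub>R ?d" ?u] by (simp add: sq)
  ultimately have le: "((1 + a * c) * nrm ?u) * nrm ?u \<le> nrm (?u + a *\<^sub>R ?d) * nrm ?u"
    by (simp add: distrib_right power2_eq_square mult.assoc)
  show ?thesis
  proof (cases "nrm ?u = 0")
    case False
    then have "nrm ?u > 0" using N_nonneg[of ?u] by linarith
    then show ?thesis using le by (rule mult_right_le_imp_le[rotated])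
  next
    case True
    then show ?thesis using N_nonneg by (simp del: N_eq_zero_iff)
  qed
qed

text \<open>Deimling's inequality bounds the pairing from above only; subadditivity converts it,
  for the opposite direction, into the lower bound needed here.\<close>

lemma monotone_wrt_deriv_ge:
  assumes "vector_norm nrm" and mono: "monotone_wrt nrm c H" and "x \<noteq> y"
    and D: "((\<lambda>h. (nrm (x - y + h *\<^sub>R (H x - H y)) - nrm (x - y)) / h) \<longlongrightarrow> D) (at_right 0)"
  shows "c * nrm (x - y) \<le> D"
proof -
  interpret vector_norm nrm by fact
  obtain P where P: "compatible_wp nrm P"
      and mono: "- P (- (H x - H y)) (x - y) \<ge> c * (nrm (x - y))\<^sup>2"
    using mono by (auto simp: monotone_wrt_def)
  let ?u = "x - y" and ?d = "H x - H y"
  have "P (0 *\<^sub>R 0) ?u = 0 * P 0 ?u" using P unfolding compatible_wp_def by blast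
  then have "0 = P (- ?d + ?d) ?u" by simp
  also have "\<dots> \<le> P (- ?d) ?u + P ?d ?u" using P unfolding compatible_wp_def by blast
  also have "P ?d ?u \<le> nrm ?u * D" using P D unfolding compatible_wp_def by blast
  finally have "nrm ?u * (c * nrm ?u) \<le> nrm ?u * D"
    using mono by (simp add: power2_eq_square algebra_simps)
  moreover have "nrm ?u > 0" using \<open>x \<noteq> y\<close> by (intro N_pos) simp
  ultimately show ?thesis by (rule mult_left_le_imp_le)
qed

text \<open>An eventual equality instead of a limit: the difference quotients of the weighted norms
  then become constant for small \<open>h\<close>, and Deimling's inequality can be
  evaluated.\<close>

lemma abs_right_derivative:
  fixes u d :: real
  assumes "u \<noteq> 0"
  shows "\<forall>\<^sub>F h in at_right 0. \<bar>u + h * d\<bar> = \<bar>u\<bar> + h * (sgn u * d)"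
proof -
  have "((\<lambda>h. \<bar>u\<bar> - \<bar>h * d\<bar>) \<longlongrightarrow> \<bar>u\<bar> - \<bar>0 * d\<bar>) (at_right 0)" by (intro tendsto_intros)
  then have "\<forall>\<^sub>F h in at_right 0. 0 < \<bar>u\<bar> - \<bar>h * d\<bar>"
    using assms by (intro order_tendstoD(1)) auto
  then show ?thesis
    by eventually_elim (auto simp: abs_if sgn_if split: if_splits)
qed

text \<open>Away from the coordinate hyperplanes the 1-norm is locally linear; the right-hand side
  is its slope at x - y in direction H x - H y.\<close>

lemma monotone_norm1w_nonzero:
  fixes eta :: "real^'n"
  assumes eta: "\<forall>i. eta $ i > 0" and mono: "monotone_wrt (norm1w eta) c H"
    and nz: "\<And>i. (x - y) $ i \<noteq> 0"
  shows "c * norm1w eta (x - y) \<le> (\<Sum>i\<in>UNIV. eta $ i * (sgn ((x - y) $ i) * (H x - H y) $ i))"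
    (is "_ \<le> ?D")
proof (rule monotone_wrt_deriv_ge[OF vector_norm_norm1w[OF eta] mono])
  show "x \<noteq> y" using nz by auto
  let ?u = "x - y" and ?d = "H x - H y"
  have "\<forall>\<^sub>F h in at_right 0. \<forall>i\<in>UNIV. \<bar>?u $ i + h * ?d $ i\<bar> = \<bar>?u $ i\<bar> + h * (sgn (?u $ i) * ?d $ i)"
    by (intro eventually_ball_finite ballI abs_right_derivative nz) simp
  moreover have "\<forall>\<^sub>F h in at_right (0::real). h > 0" by (rule eventually_at_right_less)
  ultimately have "\<forall>\<^sub>F h in at_right 0. (norm1w eta (?u + h *\<^sub>R ?d) - norm1w eta ?u) / h = ?D"
  proof eventually_elim
    case (elim h)
    have "norm1w eta (?u + h *\<^sub>R ?d) = (\<Sum>i\<in>UNIV. eta $ i * (\<bar>?u $ i\<bar> + h * (sgn (?u $ i) * ?d $ i)))"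
      unfolding norm1w_def using elim(1) by (intro sum.cong) auto
    also have "\<dots> = norm1w eta ?u + h * ?D"
      by (simp add: norm1w_def distrib_left sum.distrib sum_distrib_left mult.left_commute)
    finally show ?case using elim(2) by simp
  qed
  then show "((\<lambda>h. (norm1w eta (?u + h *\<^sub>R ?d) - norm1w eta ?u) / h) \<longlongrightarrow> ?D) (at_right 0)"
    by (rule tendsto_eventually)
qed

lemma norm1w_axis: "norm1w eta (axis j t) = eta $ j * \<bar>t\<bar>"
  by (simp add: norm1w_def axis_def if_distrib[of abs] if_distrib[of "\<lambda>z. _ * z"] cong: if_cong)

text \<open>The vanishing coordinates of the difference of the arguments are perturbed with signs opposite
  to those of \<open>d\<close>, which produces the off-diagonal sum.\<close>

lemma monotone_norm1w_axis:
  fixes eta x :: "real^'n" and t :: real and j :: 'n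
  assumes eta: "\<forall>i. eta $ i > 0" and mono: "monotone_wrt (norm1w eta) c H"
    and cont: "continuous_on UNIV H" and "t \<noteq> 0"
  defines "d \<equiv> H (x + axis j t) - H x"
  shows "c * (eta $ j * \<bar>t\<bar>) + (\<Sum>i\<in>UNIV - {j}. eta $ i * \<bar>d $ i\<bar>) \<le> eta $ j * (sgn t * d $ j)"
proof -
  interpret vector_norm "norm1w eta" by (rule vector_norm_norm1w[OF eta])
  \<comment> \<open>At \<open>d $ i = 0\<close> the value is 1 and not 0: the sign is irrelevant
    there, but no coordinate of \<open>z e - x\<close> may vanish.\<close>
  define w :: "real^'n" where "w = (\<chi> i. if i = j then 0 else if d $ i > 0 then - 1 else 1)"
  define z where "z e = x + axis j t + e *\<^sub>R w" for e
  let ?D = "\<lambda>e. \<Sum>i\<in>UNIV. eta $ i * ((if i = j then sgn t else w $ i) * (H (z e) - H x) $ i)"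
  have le: "c * norm1w eta (z e - x) \<le> ?D e" if "e > 0" for e
  proof -
    have sgn: "sgn ((z e - x) $ i) = (if i = j then sgn t else w $ i)" for i
      using that by (simp add: z_def w_def axis_def)
    have "(z e - x) $ i \<noteq> 0" for i
      using that \<open>t \<noteq> 0\<close> by (simp add: z_def w_def axis_def)
    then show ?thesis using monotone_norm1w_nonzero[OF eta mono] unfolding sgn[symmetric] by blast
  qed
  have "(z \<longlongrightarrow> x + axis j t + 0 *\<^sub>R w) (at_right 0)"
    unfolding z_def by (intro tendsto_intros)
  then have z: "(z \<longlongrightarrow> x + axis j t) (at_right 0)" by simp
  have Hz: "((\<lambda>e. H (z e)) \<longlongrightarrow> H (x + axis j t)) (at_right 0)"
    by (rule continuous_on_tendsto_compose[OF cont z UNIV_I]) simp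
  have "c * norm1w eta (x + axis j t - x)
      \<le> (\<Sum>i\<in>UNIV. eta $ i * ((if i = j then sgn t else w $ i) * d $ i))"
  proof (rule tendsto_le)
    show "((\<lambda>e. c * norm1w eta (z e - x)) \<longlongrightarrow> c * norm1w eta (x + axis j t - x)) (at_right 0)"
      by (intro tendsto_mult_left N_tendsto tendsto_intros z)
    show "(?D \<longlongrightarrow> (\<Sum>i\<in>UNIV. eta $ i * ((if i = j then sgn t else w $ i) * d $ i))) (at_right 0)"
      unfolding d_def by (intro tendsto_intros Hz)
    show "\<forall>\<^sub>F e in at_right 0. c * norm1w eta (z e - x) \<le> ?D e"
      using eventually_at_right_less[of "0::real"] by eventually_elim (rule le)
  qed simp
  also have "\<dots> = eta $ j * (sgn t * d $ j) + (\<Sum>i\<in>UNIV - {j}. eta $ i * (w $ i * d $ i))"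
    by (subst sum.remove[of _ j]) auto
  also have "(\<Sum>i\<in>UNIV - {j}. eta $ i * (w $ i * d $ i)) = (\<Sum>i\<in>UNIV - {j}. - (eta $ i * \<bar>d $ i\<bar>))"
    by (intro sum.cong) (auto simp: w_def)
  finally show ?thesis by (simp add: norm1w_axis sum_negf)
qed

text \<open>Several coordinates may attain the norm, where it has a kink. Moving \<open>x\<close>
  outwards by \<open>e\<close> along the i-th axis makes i the only maximal coordinate, so near the
  new difference the norm is just the weighted absolute value of that coordinate; then
  \<open>e\<close> tends to 0.\<close>

lemma monotone_norminfw_maximal:
  fixes eta :: "real^'n"
  assumes eta: "\<forall>i. eta $ i > 0" and mono: "monotone_wrt (norminfw eta) c H"
    and cont: "continuous_on UNIV H"
    and max: "\<bar>(x - y) $ i\<bar> = norminfw eta (x - y) * eta $ i" and "x \<noteq> y"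
  shows "c * \<bar>(x - y) $ i\<bar> \<le> sgn ((x - y) $ i) * (H x - H y) $ i"
proof -
  interpret vector_norm "norminfw eta" by (rule vector_norm_norminfw[OF eta])
  define \<sigma> where "\<sigma> = sgn ((x - y) $ i)"
  have M: "norminfw eta (x - y) > 0" using \<open>x \<noteq> y\<close> by (intro N_pos) simp
  then have "\<bar>(x - y) $ i\<bar> > 0" using max eta by simp
  then have nz: "(x - y) $ i \<noteq> 0" by simp
  define z where "z e = x + axis i (e * \<sigma>)" for e
  have le: "c * norminfw eta (z e - y) \<le> \<sigma> * (H (z e) - H y) $ i / eta $ i" if "e > 0" for e
  proof (rule monotone_wrt_deriv_ge[OF vector_norm_norminfw[OF eta] mono])
    let ?u = "z e - y" and ?d = "H (z e) - H y"
    have ui: "\<bar>?u $ i\<bar> = \<bar>(x - y) $ i\<bar> + e" "sgn (?u $ i) = \<sigma>"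
      using nz that by (auto simp: z_def \<sigma>_def axis_def sgn_if)
    then show "z e \<noteq> y" using nz that by auto
    have less: "\<bar>?u $ j\<bar> / eta $ j < \<bar>?u $ i\<bar> / eta $ i" if "j \<noteq> i" for j
    proof -
      have "\<bar>?u $ j\<bar> / eta $ j \<le> norminfw eta (x - y)"
        using norminfw_bound[OF eta, of "x - y" j] eta \<open>j \<noteq> i\<close>
        by (simp add: z_def axis_def pos_divide_le_eq)
      also have "\<dots> = \<bar>(x - y) $ i\<bar> / eta $ i" using max eta by (simp add: less_imp_neq[THEN not_sym])
      also have "\<dots> < \<bar>?u $ i\<bar> / eta $ i"
        using eta \<open>e > 0\<close> by (simp add: ui(1) divide_strict_right_mono del: vector_minus_component)
      finally show ?thesis .
    qed
    have "\<forall>\<^sub>F h in at_right 0. \<bar>(?u + h *\<^sub>R ?d) $ j\<bar> / eta $ j \<le> \<bar>(?u + h *\<^sub>R ?d) $ i\<bar> / eta $ i" for j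
    proof (cases "j = i")
      case False
      have "((\<lambda>h. \<bar>(?u + h *\<^sub>R ?d) $ i\<bar> / eta $ i - \<bar>(?u + h *\<^sub>R ?d) $ j\<bar> / eta $ j)
          \<longlongrightarrow> \<bar>(?u + 0 *\<^sub>R ?d) $ i\<bar> / eta $ i - \<bar>(?u + 0 *\<^sub>R ?d) $ j\<bar> / eta $ j) (at_right 0)"
        using eta by (intro tendsto_intros) (auto simp: less_imp_neq[THEN not_sym])
      then have "\<forall>\<^sub>F h in at_right 0. 0 < \<bar>(?u + h *\<^sub>R ?d) $ i\<bar> / eta $ i - \<bar>(?u + h *\<^sub>R ?d) $ j\<bar> / eta $ j"
        using less[OF False] by (intro order_tendstoD(1)) auto
      then show ?thesis by eventually_elim simp
    qed simp
    then have ev: "\<forall>\<^sub>F h in at_right 0. \<forall>j\<in>UNIV. \<bar>(?u + h *\<^sub>R ?d) $ j\<bar> / eta $ j \<le> \<bar>(?u + h *\<^sub>R ?d) $ i\<bar> / eta $ i"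
      by (intro eventually_ball_finite ballI) simp_all
    have max_eq: "norminfw eta v = \<bar>v $ i\<bar> / eta $ i"
      if "\<forall>j\<in>UNIV. \<bar>v $ j\<bar> / eta $ j \<le> \<bar>v $ i\<bar> / eta $ i" for v
      unfolding norminfw_def using that by (intro Max_eqI) auto
    have u_eq: "norminfw eta ?u = \<bar>?u $ i\<bar> / eta $ i"
      using less by (intro max_eq ballI) (metis less_imp_le order_refl)
    have nz': "?u $ i \<noteq> 0" using ui(1) nz \<open>e > 0\<close> by auto
    have "\<forall>\<^sub>F h in at_right (0::real). h > 0" by (rule eventually_at_right_less)
    with ev abs_right_derivative[OF nz', of "?d $ i"]
    have "\<forall>\<^sub>F h in at_right 0. (norminfw eta (?u + h *\<^sub>R ?d) - norminfw eta ?u) / h = \<sigma> * ?d $ i / eta $ i"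
    proof eventually_elim
      case (elim h)
      have "norminfw eta (?u + h *\<^sub>R ?d) = \<bar>?u $ i + h * ?d $ i\<bar> / eta $ i"
        using max_eq[OF elim(1)] by simp
      also have "\<dots> = norminfw eta ?u + h * (\<sigma> * ?d $ i / eta $ i)"
        unfolding elim(2) u_eq ui(2) by (simp add: add_divide_distrib)
      finally show ?case using elim(3) by simp
    qed
    then show "((\<lambda>h. (norminfw eta (?u + h *\<^sub>R ?d) - norminfw eta ?u) / h) \<longlongrightarrow> \<sigma> * ?d $ i / eta $ i) (at_right 0)"
      by (rule tendsto_eventually)
  qed
  have axis_eq: "axis i (e * \<sigma>) = e *\<^sub>R axis i \<sigma>" for e by (simp add: vec_eq_iff axis_def)
  have "(z \<longlongrightarrow> x + 0 *\<^sub>R axis i \<sigma>) (at_right 0)"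
    unfolding z_def axis_eq by (intro tendsto_intros)
  then have z: "(z \<longlongrightarrow> x) (at_right 0)" by simp
  have Hz: "((\<lambda>e. H (z e)) \<longlongrightarrow> H x) (at_right 0)"
    by (rule continuous_on_tendsto_compose[OF cont z UNIV_I]) simp
  have "c * norminfw eta (x - y) \<le> \<sigma> * (H x - H y) $ i / eta $ i"
  proof (rule tendsto_le)
    show "((\<lambda>e. c * norminfw eta (z e - y)) \<longlongrightarrow> c * norminfw eta (x - y)) (at_right 0)"
      by (intro tendsto_mult_left N_tendsto tendsto_intros z)
    show "((\<lambda>e. \<sigma> * (H (z e) - H y) $ i / eta $ i) \<longlongrightarrow> \<sigma> * (H x - H y) $ i / eta $ i) (at_right 0)"
      using eta by (intro tendsto_intros Hz) (auto simp: less_imp_neq[THEN not_sym])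
    show "\<forall>\<^sub>F e in at_right 0. c * norminfw eta (z e - y) \<le> \<sigma> * (H (z e) - H y) $ i / eta $ i"
      using eventually_at_right_less[of "0::real"] by eventually_elim (rule le)
  qed simp
  then show ?thesis using eta by (simp add: \<sigma>_def[symmetric] max pos_le_divide_eq mult.assoc del: vector_minus_component)
qed

subsection \<open>The forward step\<close>

lemma has_derivative_imp_right_quotient_tendsto:
  assumes "(f has_derivative A) (at x)"
  shows "(right_quotient f v x \<longlongrightarrow> A v) (at_right 0)"
proof -
  have A: "linear A" using assms by (rule has_derivative_linear)
  have "((\<lambda>t. x + t *\<^sub>R v) has_derivative (\<lambda>t. t *\<^sub>R v)) (at 0)"
    by (auto intro!: derivative_eq_intros)
  then have "((\<lambda>t. f (x + t *\<^sub>R v)) has_derivative (\<lambda>t. A (t *\<^sub>R v))) (at 0)"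
    using assms by (intro has_derivative_compose[of _ _ 0 UNIV f A]) auto
  then have "((\<lambda>t. f (x + t *\<^sub>R v)) has_field_derivative A v) (at 0)"
    by (rule has_derivative_imp_has_field_derivative) (simp add: linear_scale[OF A])
  then have "((\<lambda>h. right_quotient f v x h) \<longlongrightarrow> A v) (at 0)"
    by (simp add: DERIV_def right_quotient_def)
  then show ?thesis by (rule filterlim_mono[OF _ order_refl]) (simp add: at_le)
qed

section \<open>Increments along the axes bounded by \<open>diagL\<close>\<close>

lemma lipschitz_on_component:
  fixes F :: "'a::metric_space \<Rightarrow> real^'n"
  assumes "L-lipschitz_on UNIV F"
  shows "L-lipschitz_on UNIV (\<lambda>x. F x $ i)"
proof (rule lipschitz_onI)
  fix x y
  have "dist (F x $ i) (F y $ i) \<le> dist (F x) (F y)" by (rule dist_vec_nth_le)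
  also have "\<dots> \<le> L * dist x y" using lipschitz_onD[OF assms] by blast
  finally show "dist (F x $ i) (F y $ i) \<le> L * dist x y" .
qed (rule lipschitz_on_nonneg[OF assms])

lemma frechet_derivative_right_quotient_tendsto:
  fixes F :: "real^'n \<Rightarrow> real^'n"
  assumes "F differentiable (at x)"
  shows "(right_quotient (\<lambda>x. F x $ i) v x \<longlongrightarrow> frechet_derivative F (at x) v $ i) (at_right 0)"
proof (rule has_derivative_imp_right_quotient_tendsto)
  have "(F has_derivative frechet_derivative F (at x)) (at x)"
    using assms frechet_derivative_works by blast
  then show "((\<lambda>x. F x $ i) has_derivative (\<lambda>v. frechet_derivative F (at x) v $ i)) (at x)"
    by (rule bounded_linear.has_derivative[OF bounded_linear_vec_nth])
qed

text \<open>A supremum of reals is meaningful only for a set bounded above. The Lipschitz constant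
  is such a bound, since diagonal entries are limits of quotients along unit vectors.\<close>

lemma frechet_derivative_le_diagL:
  fixes F :: "real^'n \<Rightarrow> real^'n"
  assumes lip: "L-lipschitz_on UNIV F" and "F differentiable (at x)"
  shows "frechet_derivative F (at x) (axis i 1) $ i \<le> diagL F"
  unfolding diagL_def
proof (rule cSup_upper)
  show "bdd_above {frechet_derivative F (at x) (axis i 1) $ i |x i. F differentiable at x}"
  proof (rule bdd_aboveI)
    fix r assume "r \<in> {frechet_derivative F (at x) (axis i 1) $ i |x i. F differentiable at x}"
    then obtain x i where r: "r = frechet_derivative F (at x) (axis i 1) $ i" and "F differentiable at x"
      by blast
    then have "(right_quotient (\<lambda>x. F x $ i) (axis i 1) x \<longlongrightarrow> r) (at_right 0)"
      using frechet_derivative_right_quotient_tendsto by blast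
    then show "r \<le> L"
    proof (rule tendsto_upperbound)
      have "right_quotient (\<lambda>x. F x $ i) (axis i 1) x h \<le> L" for h
        using right_quotient_bound[OF lipschitz_on_component[OF lip], of i "axis i 1" x h]
        by (simp add: norm_axis_1)
      then show "\<forall>\<^sub>F h in at_right 0. right_quotient (\<lambda>x. F x $ i) (axis i 1) x h \<le> L" by simp
    qed simp
  qed
qed (use assms(2) in blast)

lemma increment_le_diagL:
  fixes F :: "real^'n \<Rightarrow> real^'n"
  assumes lip: "L-lipschitz_on UNIV F" and "s \<ge> 0"
  shows "F (x + axis i s) $ i - F x $ i \<le> s * diagL F"
proof -
  have "AE x in lborel. right_deriv (\<lambda>x. F x $ i) (axis i 1) x \<le> diagL F"
    using rademacher[OF lip]
  proof eventually_elim
    case (elim x)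
    then show ?case
      using right_derivI(2)[OF frechet_derivative_right_quotient_tendsto[OF elim]]
        frechet_derivative_le_diagL[OF lip elim] by simp
  qed
  then have "F (x + s *\<^sub>R axis i 1) $ i - F x $ i \<le> s * diagL F"
    by (rule increment_le_if_derivative_le_AE[OF lipschitz_on_component[OF lip] _ \<open>s \<ge> 0\<close>])
  moreover have "s *\<^sub>R axis i 1 = axis i s" by (simp add: vec_eq_iff axis_def)
  ultimately show ?thesis by simp
qed

text \<open>After a step \<open>t\<close> along axis j with increment d of \<open>F\<close>, the
  diagonal part t - a d_j does not change sign because \<open>a * diagL F \<le> 1\<close>, and
  \<open>monotone_norm1w_axis\<close> pays for the off-diagonal part. Summing over the axes loses
  nothing, as the weighted 1-norm of x - y is the sum of the norms of its axis components.\<close>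

lemma forward_step_norm1w:
  fixes eta :: "real^'n"
  assumes eta: "\<forall>i. eta $ i > 0" and mono: "monotone_wrt (norm1w eta) c F"
    and lip: "L-lipschitz_on UNIV F" and a: "a \<ge> 0" "a * diagL F \<le> 1"
  shows "norm1w eta (x - y - a *\<^sub>R (F x - F y)) \<le> (1 - a * c) * norm1w eta (x - y)"
proof -
  interpret vector_norm "norm1w eta" by (rule vector_norm_norm1w[OF eta])
  have cont: "continuous_on UNIV F" using lip by (rule lipschitz_on_continuous_on)
  have axis_step: "norm1w eta (axis j t - a *\<^sub>R (F (z + axis j t) - F z)) \<le> (1 - a * c) * (eta $ j * \<bar>t\<bar>)"
    for z j t
  proof (cases "t = 0")
    case True
    then show ?thesis by (simp add: axis_def flip: zero_vec_def)
  next
    case False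
    define d where "d = F (z + axis j t) - F z"
    have slope: "sgn t * d $ j \<le> \<bar>t\<bar> * diagL F"
    proof (cases "t > 0")
      case True
      then show ?thesis using increment_le_diagL[OF lip, of t z j] by (simp add: d_def)
    next
      case neg: False
      \<comment> \<open>For negative \<open>t\<close> the increment bound is applied from the other
        end point, moving by \<open>- t\<close>.\<close>
      have "z + axis j t + axis j (- t) = z" by (simp add: vec_eq_iff axis_def)
      then show ?thesis
        using increment_le_diagL[OF lip, of "- t" "z + axis j t" j] neg False by (simp only:) (simp add: d_def)
    qed
    have "a * (sgn t * d $ j) \<le> a * (\<bar>t\<bar> * diagL F)" using slope a(1) by (rule mult_left_mono)
    also have "\<dots> = \<bar>t\<bar> * (a * diagL F)" by simp
    also have "\<dots> \<le> \<bar>t\<bar>" using a(2) by (simp add: mult_left_le)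
    finally have small: "a * (sgn t * d $ j) \<le> \<bar>t\<bar>" .
    have "\<bar>t - a * d $ j\<bar> = \<bar>t\<bar> - a * (sgn t * d $ j)"
      using small False by (cases "t > 0") (auto simp: abs_if)
    then have "norm1w eta (axis j t - a *\<^sub>R d) =
        eta $ j * (\<bar>t\<bar> - a * (sgn t * d $ j)) + (\<Sum>i\<in>UNIV - {j}. eta $ i * (a * \<bar>d $ i\<bar>))"
      unfolding norm1w_def using a(1)
      by (subst sum.remove[of _ j]) (auto simp: axis_def abs_mult intro!: sum.cong)
    also have "\<dots> = eta $ j * \<bar>t\<bar> - a * (eta $ j * (sgn t * d $ j) - (\<Sum>i\<in>UNIV - {j}. eta $ i * \<bar>d $ i\<bar>))"
      by (simp add: algebra_simps sum_distrib_left)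
    also have "\<dots> \<le> eta $ j * \<bar>t\<bar> - a * (c * (eta $ j * \<bar>t\<bar>))"
      using monotone_norm1w_axis[OF eta mono cont False, of j z] a(1)
      by (intro diff_left_mono mult_left_mono) (auto simp: d_def)
    finally show ?thesis by (simp add: d_def algebra_simps)
  qed
  define p where "p S = (\<chi> i. if i \<in> S then x $ i else y $ i)" for S
  have "norm1w eta (p S - y - a *\<^sub>R (F (p S) - F y)) \<le> (1 - a * c) * (\<Sum>i\<in>S. eta $ i * \<bar>(x - y) $ i\<bar>)"
    if "finite S" for S
    using that
  proof (induction S)
    case empty
    have "p {} = y" by (simp add: p_def vec_eq_iff)
    then show ?case by simp
  next
    case (insert j S)
    let ?t = "(x - y) $ j"
    have p: "p (insert j S) = p S + axis j ?t"
      using insert.hyps by (auto simp: p_def vec_eq_iff axis_def)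
    have "p (insert j S) - y - a *\<^sub>R (F (p (insert j S)) - F y) =
        (p S - y - a *\<^sub>R (F (p S) - F y)) + (axis j ?t - a *\<^sub>R (F (p S + axis j ?t) - F (p S)))"
      unfolding p by (simp add: algebra_simps)
    then have "norm1w eta (p (insert j S) - y - a *\<^sub>R (F (p (insert j S)) - F y)) \<le>
        norm1w eta (p S - y - a *\<^sub>R (F (p S) - F y)) +
        norm1w eta (axis j ?t - a *\<^sub>R (F (p S + axis j ?t) - F (p S)))"
      by (simp only: N_triangle)
    also have "\<dots> \<le> (1 - a * c) * (\<Sum>i\<in>S. eta $ i * \<bar>(x - y) $ i\<bar>) + (1 - a * c) * (eta $ j * \<bar>?t\<bar>)"
      by (rule add_mono[OF insert.IH axis_step])
    finally show ?case
      using insert.hyps by (simp add: distrib_left add.commute)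
  qed
  moreover have "p UNIV = x" by (simp add: p_def vec_eq_iff)
  ultimately show ?thesis by (metis finite_class.finite_UNIV norm1w_def)
qed

text \<open>Each row is treated on its own. Let s be what coordinate i lacks to attain the norm with
  sign \<sigma>. Pushing the coordinate by s increases \<sigma> times the i-th component of
  \<open>F\<close> by at most \<open>s * diagL F\<close>, and at the new point the estimate for
  maximal coordinates applies. The loss \<open>a * s * diagL F\<close> is at most s, which is
  exactly the gap available.\<close>

lemma forward_step_norminfw:
  fixes eta :: "real^'n"
  assumes eta: "\<forall>i. eta $ i > 0" and mono: "monotone_wrt (norminfw eta) c F"
    and lip: "L-lipschitz_on UNIV F" and a: "a \<ge> 0" "a * diagL F \<le> 1"
  shows "norminfw eta (x - y - a *\<^sub>R (F x - F y)) \<le> (1 - a * c) * norminfw eta (x - y)"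
proof (cases "x = y")
  case True
  interpret vector_norm "norminfw eta" by (rule vector_norm_norminfw[OF eta])
  show ?thesis using True by simp
next
  case False
  interpret vector_norm "norminfw eta" by (rule vector_norm_norminfw[OF eta])
  have cont: "continuous_on UNIV F" using lip by (rule lipschitz_on_continuous_on)
  define M where "M = norminfw eta (x - y)"
  have M: "M > 0" unfolding M_def using False by (intro N_pos) simp
  have bound: "\<sigma> * (x - y - a *\<^sub>R (F x - F y)) $ i \<le> (1 - a * c) * M * eta $ i"
    if \<sigma>: "\<sigma> = 1 \<or> \<sigma> = - 1" for \<sigma> i
  proof -
    txt \<open>Push the \<open>i\<close>-th coordinate of \<open>x\<close> until it attains the norm of the difference to \<open>y\<close>.\<close>
    define s where "s = M * eta $ i - \<sigma> * (x - y) $ i"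
    have s: "s \<ge> 0" using norminfw_bound[OF eta, of "x - y" i] \<sigma> by (auto simp: s_def M_def abs_le_iff)
    define z where "z = x + axis i (\<sigma> * s)"
    have Me: "M * eta $ i > 0" using M eta by simp
    have zi: "(z - y) $ i = \<sigma> * (M * eta $ i)"
      using \<sigma> by (auto simp: z_def axis_def s_def)
    have "\<bar>\<sigma> * K\<bar> = K" "sgn (\<sigma> * K) = \<sigma>" if "K > 0" for K :: real
      using \<sigma> that by auto
    then have abs_zi: "\<bar>(z - y) $ i\<bar> = M * eta $ i" and sgn_zi: "sgn ((z - y) $ i) = \<sigma>"
      using Me unfolding zi by blast+
    have "norminfw eta (z - y) = M"
    proof (rule antisym)
      show "norminfw eta (z - y) \<le> M"
      proof (rule norminfw_le[OF eta])
        fix j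
        show "\<bar>(z - y) $ j\<bar> \<le> M * eta $ j"
        proof (cases "j = i")
          case True
          then show ?thesis using abs_zi by simp
        next
          case False
          then show ?thesis using norminfw_bound[OF eta, of "x - y" j] by (simp add: z_def axis_def M_def)
        qed
      qed
      have "M * eta $ i \<le> norminfw eta (z - y) * eta $ i"
        using norminfw_bound[OF eta, of "z - y" i] abs_zi by simp
      then show "M \<le> norminfw eta (z - y)" using eta by (metis mult_right_le_imp_le)
    qed
    then have "\<bar>(z - y) $ i\<bar> = norminfw eta (z - y) * eta $ i" using abs_zi by simp
    moreover have "z \<noteq> y" using abs_zi Me by auto
    ultimately have "c * \<bar>(z - y) $ i\<bar> \<le> sgn ((z - y) $ i) * (F z - F y) $ i"
      by (rule monotone_norminfw_maximal[OF eta mono cont])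
    then have mono_z: "c * (M * eta $ i) \<le> \<sigma> * (F z - F y) $ i"
      by (simp only: abs_zi sgn_zi)
    have slope: "\<sigma> * (F z - F x) $ i \<le> s * diagL F"
    proof (cases "\<sigma> = 1")
      case True
      then show ?thesis using increment_le_diagL[OF lip s, of x i] by (simp add: z_def)
    next
      case neg: False
      then have "z + axis i s = x" using \<sigma> by (simp add: z_def vec_eq_iff axis_def)
      then show ?thesis using increment_le_diagL[OF lip s, of z i] neg \<sigma> by simp
    qed
    have "c * (M * eta $ i) - s * diagL F \<le> \<sigma> * (F x - F y) $ i"
      using mono_z slope by (simp add: algebra_simps)
    then have "a * (c * (M * eta $ i) - s * diagL F) \<le> a * (\<sigma> * (F x - F y) $ i)"
      using a(1) by (rule mult_left_mono)
    moreover have "a * diagL F * s \<le> 1 * s" using a(2) s by (rule mult_right_mono)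
    ultimately show ?thesis by (simp add: s_def algebra_simps)
  qed
  show ?thesis unfolding M_def[symmetric]
  proof (rule norminfw_le[OF eta])
    show "\<bar>(x - y - a *\<^sub>R (F x - F y)) $ i\<bar> \<le> (1 - a * c) * M * eta $ i" for i
      using bound[of 1 i] bound[of "- 1" i] by (simp add: abs_le_iff)
  qed
qed

text \<open>A unit step along one axis has slope at least \<open>c\<close> and at most
  \<open>diagL F\<close>. This makes \<open>1 / diagL F\<close> positive for \<open>c > 0\<close>
  and keeps \<open>1 - a * c\<close> nonnegative for admissible steps.\<close>

lemma le_diagL_norm1w:
  fixes eta :: "real^'n"
  assumes eta: "\<forall>i. eta $ i > 0" and mono: "monotone_wrt (norm1w eta) c F"
    and lip: "L-lipschitz_on UNIV F"
  shows "c \<le> diagL F"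
proof -
  fix i :: 'n
  have cont: "continuous_on UNIV F" using lip by (rule lipschitz_on_continuous_on)
  have "0 \<le> (\<Sum>j\<in>UNIV - {i}. eta $ j * \<bar>(F (0 + axis i 1) - F 0) $ j\<bar>)"
    using eta by (intro sum_nonneg mult_nonneg_nonneg) (auto simp: less_imp_le)
  then have "eta $ i * c \<le> eta $ i * (F (0 + axis i 1) - F 0) $ i"
    using monotone_norm1w_axis[OF eta mono cont, of 1 i 0] by (simp add: mult.commute)
  then have "c \<le> (F (0 + axis i 1) - F 0) $ i" using eta by (metis mult_left_le_imp_le)
  also have "\<dots> \<le> diagL F" using increment_le_diagL[OF lip, of 1 0 i] by simp
  finally show ?thesis .
qed

lemma le_diagL_norminfw:
  fixes eta :: "real^'n"
  assumes eta: "\<forall>i. eta $ i > 0" and mono: "monotone_wrt (norminfw eta) c F"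
    and lip: "L-lipschitz_on UNIV F"
  shows "c \<le> diagL F"
proof -
  fix i :: 'n
  have cont: "continuous_on UNIV F" using lip by (rule lipschitz_on_continuous_on)
  let ?e = "axis i 1 :: real^'n"
  have "norminfw eta ?e = 1 / eta $ i"
  proof (rule antisym)
    show "norminfw eta ?e \<le> 1 / eta $ i"
      using eta by (intro norminfw_le[OF eta]) (auto simp: axis_def less_imp_neq[THEN not_sym] less_imp_le)
    show "1 / eta $ i \<le> norminfw eta ?e"
      using norminfw_bound[OF eta, of ?e i] eta by (simp add: pos_divide_le_eq)
  qed
  moreover have "?e \<noteq> 0" by (simp add: axis_eq_0_iff)
  moreover have "eta $ i \<noteq> 0" using eta by (metis less_irrefl)
  ultimately have "c \<le> (F ?e - F 0) $ i"
    using monotone_norminfw_maximal[OF eta mono cont, of ?e 0 i] by simp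
  also have "\<dots> \<le> diagL F" using increment_le_diagL[OF lip, of 1 0 i] by simp
  finally show ?thesis .
qed

subsection \<open>Forward-backward splitting\<close>

lemma lipschitz_wrt_imp_lipschitz_on:
  assumes "vector_norm nrm" and "lipschitz_wrt nrm F"
  shows "\<exists>L. L-lipschitz_on UNIV F"
proof -
  interpret vector_norm nrm by fact
  obtain L where L: "\<And>x y. nrm (F x - F y) \<le> L * nrm (x - y)"
    using assms(2) by (auto simp: lipschitz_wrt_def)
  obtain c where c: "c > 0" "\<And>x. c * norm x \<le> nrm x" using lower_bound_norm by blast
  obtain C where C: "C > 0" "\<And>x. nrm x \<le> C * norm x" using upper_bound_norm by blast
  have "(\<bar>L\<bar> * C / c)-lipschitz_on UNIV F"
  proof (rule lipschitz_onI)
    fix x y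
    have "c * norm (F x - F y) \<le> nrm (F x - F y)" by (rule c)
    also have "\<dots> \<le> L * nrm (x - y)" by (rule L)
    also have "\<dots> \<le> \<bar>L\<bar> * nrm (x - y)" by (intro mult_right_mono) auto
    also have "\<dots> \<le> \<bar>L\<bar> * (C * norm (x - y))" by (intro mult_left_mono C) auto
    finally show "dist (F x) (F y) \<le> \<bar>L\<bar> * C / c * dist x y"
      using c(1) by (simp add: dist_norm field_simps)
  qed (use c C in simp)
  then show ?thesis by blast
qed

text \<open>Beyond continuity, all that is known of \<open>F\<close> here is \<open>forward\<close>.
  The shape of the particular weighted norm has been used up in proving it, so both norms are now
  treated alike.\<close>

locale monotone_splitting = vector_norm nrm for nrm :: "real^'n \<Rightarrow> real" +
  fixes F G :: "real^'n \<Rightarrow> real^'n" and a c :: real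
  assumes G_cont: "continuous_on UNIV G" and G_mono: "monotone_wrt nrm 0 G"
    and F_cont: "continuous_on UNIV F" and a_pos: "a > 0"
    and forward: "nrm (x - y - a *\<^sub>R (F x - F y)) \<le> (1 - a * c) * nrm (x - y)"
begin

lemma G_expansive: "nrm (x - y) \<le> nrm (x - y + a *\<^sub>R (G x - G y))"
  using monotone_wrt_expansive[OF vector_norm_axioms G_mono, of a x y] a_pos by simp

lemma resolvent_eq: "resolvent a G y + a *\<^sub>R G (resolvent a G y) = y"
  and resolvent_unique: "x + a *\<^sub>R G x = y \<Longrightarrow> resolvent a G y = x"
proof -
  have "bij (\<lambda>x. x + a *\<^sub>R G x)"
  proof (rule bij_if_expansive[where k = 1])
    show "1 * nrm (x - y) \<le> nrm (x + a *\<^sub>R G x - (y + a *\<^sub>R G y))" for x y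
      using G_expansive[of x y] by (simp add: algebra_simps)
  qed (auto intro!: continuous_intros G_cont)
  then have ex1: "\<exists>!x. x + a *\<^sub>R G x = y" for y by (auto simp: bij_iff)
  show "resolvent a G y + a *\<^sub>R G (resolvent a G y) = y"
    unfolding resolvent_def using theI'[OF ex1] .
  show "x + a *\<^sub>R G x = y \<Longrightarrow> resolvent a G y = x"
    unfolding resolvent_def using ex1 by (intro the1_equality)
qed

lemma resolvent_nonexpansive: "nrm (resolvent a G x - resolvent a G y) \<le> nrm (x - y)"
proof -
  let ?x = "resolvent a G x" and ?y = "resolvent a G y"
  have "x - y = (?x + a *\<^sub>R G ?x) - (?y + a *\<^sub>R G ?y)" by (simp only: resolvent_eq)
  also have "\<dots> = ?x - ?y + a *\<^sub>R (G ?x - G ?y)" by (simp add: algebra_simps)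
  finally show ?thesis using G_expansive[of ?x ?y] by simp
qed

definition "fwd_bwd x = resolvent a G (x - a *\<^sub>R F x)"

lemma fwd_bwd_lipschitz: "nrm (fwd_bwd x - fwd_bwd y) \<le> (1 - a * c) * nrm (x - y)"
proof -
  have "x - a *\<^sub>R F x - (y - a *\<^sub>R F y) = x - y - a *\<^sub>R (F x - F y)" by (simp add: algebra_simps)
  then show ?thesis
    unfolding fwd_bwd_def using resolvent_nonexpansive forward[of x y] by (metis order_trans)
qed

lemma fwd_bwd_fixpoint_iff: "fwd_bwd z = z \<longleftrightarrow> F z + G z = 0"
proof
  assume "fwd_bwd z = z"
  then have "z + a *\<^sub>R G z = z - a *\<^sub>R F z"
    using resolvent_eq[of "z - a *\<^sub>R F z"] by (simp add: fwd_bwd_def)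
  then have "a *\<^sub>R (F z + G z) = 0" by (simp add: algebra_simps)
  then show "F z + G z = 0" using a_pos by simp
next
  assume "F z + G z = 0"
  then have "G z = - F z" by (simp add: eq_neg_iff_add_eq_0 add.commute)
  then show "fwd_bwd z = z" unfolding fwd_bwd_def by (intro resolvent_unique) simp
qed

text \<open>The backward difference x - y + a (G x - G y) is the forward difference plus a times the
  difference of \<open>F + G\<close>. As the former is at least as long as x - y and the forward
  difference shrinks by \<open>1 - a * c\<close>, the map \<open>F + G\<close> is expansive with
  constant \<open>c\<close>.\<close>

lemma ex1_zero:
  assumes "c > 0"
  shows "\<exists>!z. F z + G z = 0"
proof -
  have "bij (\<lambda>x. F x + G x)"
  proof (rule bij_if_expansive[where k = c])
    fix x y
    let ?s = "(F x + G x) - (F y + G y)"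
    have "nrm (x - y) \<le> nrm (x - y + a *\<^sub>R (G x - G y))" by (rule G_expansive)
    also have "x - y + a *\<^sub>R (G x - G y) = (x - y - a *\<^sub>R (F x - F y)) + a *\<^sub>R ?s"
      by (simp add: algebra_simps)
    also have "nrm \<dots> \<le> nrm (x - y - a *\<^sub>R (F x - F y)) + nrm (a *\<^sub>R ?s)" by (rule N_triangle)
    finally have "nrm (x - y) \<le> (1 - a * c) * nrm (x - y) + a * nrm ?s"
      using forward[of x y] a_pos by (simp add: N_scaleR)
    then have "a * (c * nrm (x - y)) \<le> a * nrm ?s" by (simp add: algebra_simps)
    then show "c * nrm (x - y) \<le> nrm ?s" using a_pos by simp
  qed (use assms in \<open>auto intro!: continuous_intros G_cont F_cont\<close>)
  then show ?thesis by (auto simp: bij_iff)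
qed

lemma iteration_linear_convergence:
  assumes "c > 0" and "a * c \<le> 1" and z: "F z + G z = 0"
    and xs: "\<And>k. xs (Suc k) = resolvent a G (xs k - a *\<^sub>R F (xs k))"
  shows "nrm (xs (Suc k) - z) \<le> (1 - a * c) * nrm (xs k - z)" and "xs \<longlonglongrightarrow> z"
proof -
  have step: "nrm (xs (Suc k) - z) \<le> (1 - a * c) * nrm (xs k - z)" for k
    using fwd_bwd_lipschitz[of "xs k" z] z xs[of k] by (metis fwd_bwd_def fwd_bwd_fixpoint_iff)
  then show "nrm (xs (Suc k) - z) \<le> (1 - a * c) * nrm (xs k - z)" .
  have le: "nrm (xs k - z) \<le> (1 - a * c) ^ k * nrm (xs 0 - z)" for k
  proof (induction k)
    case (Suc k)
    have "(1 - a * c) * nrm (xs k - z) \<le> (1 - a * c) * ((1 - a * c) ^ k * nrm (xs 0 - z))"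
      using Suc assms(2) by (intro mult_left_mono) auto
    with step[of k] show ?case by simp
  qed simp
  have "(\<lambda>k. (1 - a * c) ^ k) \<longlonglongrightarrow> 0"
    using assms(1,2) a_pos by (intro LIMSEQ_realpow_zero) auto
  then have "(\<lambda>k. (1 - a * c) ^ k * nrm (xs 0 - z)) \<longlonglongrightarrow> 0" by (rule tendsto_mult_left_zero)
  then have "(\<lambda>k. nrm (xs k - z)) \<longlonglongrightarrow> 0"
    by (rule Lim_null_comparison[rotated]) (use le in simp)
  then show "xs \<longlonglongrightarrow> z" by (rule tendsto_if_N_tendsto_zero)
qed

lemma averaged_iteration_converges:
  assumes "c = 0" and z: "F z + G z = 0"
    and xs: "\<And>k. xs (Suc k) = (1/2) *\<^sub>R xs k + (1/2) *\<^sub>R resolvent a G (xs k - a *\<^sub>R F (xs k))"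
  shows "\<exists>p. F p + G p = 0 \<and> xs \<longlonglongrightarrow> p"
proof -
  interpret krasnoselskii nrm fwd_bwd xs z
    using fwd_bwd_lipschitz assms by unfold_locales (simp_all add: fwd_bwd_fixpoint_iff flip: fwd_bwd_def)
  show ?thesis using iteration_converges by (simp add: fwd_bwd_fixpoint_iff)
qed

end

text \<open>As a product, the bound \<open>a * diagL F \<le> 1\<close> also covers
  \<open>diagL F = 0\<close>, which occurs in (ii) for constant \<open>F\<close> and then admits
  every \<open>a > 0\<close>.\<close>

theorem theorem33:
  fixes eta :: "real^'n" and nrm :: "real^'n \<Rightarrow> real"
    and F G :: "real^'n \<Rightarrow> real^'n" and x0 :: "real^'n"
  assumes eta_pos: "\<forall>i. eta $ i > 0"
    and nrm_def: "nrm = norm1w eta \<or> nrm = norminfw eta"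
    and F_lip: "lipschitz_wrt nrm F"
    and G_cont: "continuous_on UNIV G"
    and G_mono: "monotone_wrt nrm 0 G"
  shows
    "(\<forall>c. c > 0 \<and> monotone_wrt nrm c F \<longrightarrow>
        (\<exists>!xs. F xs + G xs = 0) \<and>
        (\<forall>a xs. a > 0 \<and> a * diagL F \<le> 1 \<and> xs 0 = x0 \<and>
            (\<forall>k. xs (Suc k) = resolvent a G (xs k - a *\<^sub>R F (xs k))) \<longrightarrow>
            xs \<longlonglongrightarrow> (THE z. F z + G z = 0) \<and>
            (\<forall>k. nrm (xs (Suc k) - (THE z. F z + G z = 0))
                   \<le> (1 - a * c) * nrm (xs k - (THE z. F z + G z = 0)))) \<and>
        (0 < 1 / diagL F \<and>
         (\<forall>a. a > 0 \<and> a * diagL F \<le> 1 \<longrightarrow> 1 - (1 / diagL F) * c \<le> 1 - a * c)))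
     \<and>
     (monotone_wrt nrm 0 F \<and> {x. F x + G x = 0} \<noteq> {} \<longrightarrow>
        (\<forall>a xs. a > 0 \<and> a * diagL F \<le> 1 \<and> xs 0 = x0 \<and>
            (\<forall>k. xs (Suc k) = (1/2) *\<^sub>R xs k
                   + (1/2) *\<^sub>R resolvent a G (xs k - a *\<^sub>R F (xs k))) \<longrightarrow>
            (\<exists>z. F z + G z = 0 \<and> xs \<longlonglongrightarrow> z)))"
proof -
  have vn: "vector_norm nrm"
    using nrm_def vector_norm_norm1w[OF eta_pos] vector_norm_norminfw[OF eta_pos] by blast
  obtain L where L: "L-lipschitz_on UNIV F"
    using lipschitz_wrt_imp_lipschitz_on[OF vn F_lip] by blast
  have splitting: "monotone_splitting nrm F G a c"
    if "monotone_wrt nrm c F" "a > 0" "a * diagL F \<le> 1" for a c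
  proof -
    have "nrm (x - y - a *\<^sub>R (F x - F y)) \<le> (1 - a * c) * nrm (x - y)" for x y
      using nrm_def that forward_step_norm1w[OF eta_pos _ L] forward_step_norminfw[OF eta_pos _ L]
      by (metis less_imp_le)
    then show ?thesis
      using vn G_cont G_mono lipschitz_on_continuous_on[OF L] that(2)
      by (simp add: monotone_splitting_def monotone_splitting_axioms_def)
  qed
  have c_le: "c \<le> diagL F" if "monotone_wrt nrm c F" for c
    using nrm_def that le_diagL_norm1w[OF eta_pos _ L] le_diagL_norminfw[OF eta_pos _ L] by blast
  show ?thesis
  proof (intro conjI allI impI; (elim conjE)?)
    fix c :: real
    assume c: "c > 0" "monotone_wrt nrm c F"
    have diagL: "diagL F > 0" using c_le[OF c(2)] c(1) by simp
    then show "0 < 1 / diagL F" by simp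
    \<comment> \<open>The zero does not depend on the step size, so one admissible step suffices for
      its existence; \<open>1 / diagL F\<close> is one, positive because
      \<open>c \<le> diagL F\<close>.\<close>
    interpret S: monotone_splitting nrm F G "1 / diagL F" c
      by (rule splitting[OF c(2)]) (use diagL in auto)
    show ex1: "\<exists>!z. F z + G z = 0" by (rule S.ex1_zero[OF c(1)])
    then have zero: "F (THE z. F z + G z = 0) + G (THE z. F z + G z = 0) = 0" by (rule theI')
    fix a :: real
    assume a: "a > 0" "a * diagL F \<le> 1"
    show "1 - 1 / diagL F * c \<le> 1 - a * c"
      using a diagL c(1) by (intro diff_left_mono mult_right_mono) (auto simp: pos_le_divide_eq)
    interpret A: monotone_splitting nrm F G a c by (rule splitting[OF c(2) a])
    have "a * c \<le> a * diagL F" using c_le[OF c(2)] a(1) by (intro mult_left_mono) auto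
    with a(2) have ac: "a * c \<le> 1" by simp
    fix xs :: "nat \<Rightarrow> real^'n"
    assume xs: "\<forall>k. xs (Suc k) = resolvent a G (xs k - a *\<^sub>R F (xs k))"
    note conv = A.iteration_linear_convergence[OF c(1) ac zero, of xs]
    show "xs \<longlonglongrightarrow> (THE z. F z + G z = 0)" using conv(2) xs by blast
    show "nrm (xs (Suc k) - (THE z. F z + G z = 0)) \<le> (1 - a * c) * nrm (xs k - (THE z. F z + G z = 0))" for k
      using conv(1) xs by blast
  next
    fix a :: real and xs :: "nat \<Rightarrow> real^'n"
    assume F_mono: "monotone_wrt nrm 0 F" and ne: "{x. F x + G x = 0} \<noteq> {}"
      and a: "a > 0" "a * diagL F \<le> 1"
      and xs: "\<forall>k. xs (Suc k) = (1/2) *\<^sub>R xs k + (1/2) *\<^sub>R resolvent a G (xs k - a *\<^sub>R F (xs k))"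
    interpret A: monotone_splitting nrm F G a 0 by (rule splitting[OF F_mono a])
    from ne obtain z where "F z + G z = 0" by blast
    then show "\<exists>z. F z + G z = 0 \<and> xs \<longlonglongrightarrow> z"
      using A.averaged_iteration_converges[OF refl, of z xs] xs by blast
  qed
qed

end
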